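(* Let $G$ be a cyclic group of prime-power order. Then \[\Delta^{\ast}(G)\cap\mathbb N_{\ge(2|G|^2)^{1/3}}=\bigcup_{m\mid |G|} I(m)\cap\mathbb N_{\ge(2|G|^2)^{1/3}}.\]
   Context: $\mathbb N_{\ge a}=\{k\in\mathbb N:k\ge a\}$. For $G_0\subseteq G$: $\mathcal B(G_0)$ is the monoid of zero-sum sequences over $G_0$, whose atoms are the minimal zero-sum sequences; $\mathsf L(B)$ is the set of lengths of factorizations of $B$ into minimal zero-sum sequences; for $L=\{\ell_1<\dots<\ell_k\}$, $\Delta(L)=\{\ell_{i+1}-\ell_i\}$; $\Delta(G_0)=\bigcup_B\Delta(\mathsf L(B))$; $\min\Delta(G_0)$ is its minimum. $\Delta^{\ast}(G)=\{\min\Delta(G_0):G_0\subseteq G,\ \Delta(G_0)\ne\emptyset\}$. For a positive integer $n$: $M(n)$ is the set of triples $(c_1,c_2,d)$ of positive integers with $c_1,c_2\in[1,n]$, $d\mid n$, such that $\frac{n-c_1-c_2}{c_1c_2}$ and $\frac{(n-c_1-c_2)d}{c_2n}$ are positive integers; $I(n)$ is the set of all integers $\gcd\left\{\frac{n-c_1-c_2}{c_1c_2},\frac{(n-c_1-c_2)d}{c_2n}\right\}$ with $(c_1,c_2,d)\in M(n)$. *)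

theory Defs
  imports Complex_Main "HOL-Library.Multiset" "HOL-Computational_Algebra.Primes"
    "HOL-Algebra.FiniteProduct" "HOL-Algebra.Elementary_Groups"
begin

(* Groups are the multiplicatively written groups of HOL-Algebra, so the "sum" of a sequence is
   a product.  A sequence over G0 is a finite multiset S with support in G0, and its sum is
   the product over all g in the support of g to the power v_g(S) = count S g. *)

definition seq_sum :: "('a, 'b) monoid_scheme \<Rightarrow> 'a multiset \<Rightarrow> 'a" where
  "seq_sum G S = (\<Otimes>\<^bsub>G\<^esub>g\<in>set_mset S. g [^]\<^bsub>G\<^esub> count S g)"

definition zero_sum_seqs :: "('a, 'b) monoid_scheme \<Rightarrow> 'a set \<Rightarrow> 'a multiset set" where
  "zero_sum_seqs G G0 = {S. set_mset S \<subseteq> G0 \<and> seq_sum G S = \<one>\<^bsub>G\<^esub>}"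

definition min_zero_sum_seqs :: "('a, 'b) monoid_scheme \<Rightarrow> 'a set \<Rightarrow> 'a multiset set" where
  "min_zero_sum_seqs G G0 =
     {U \<in> zero_sum_seqs G G0. U \<noteq> {#} \<and>
        (\<forall>T. T \<subset># U \<and> T \<noteq> {#} \<longrightarrow> T \<notin> zero_sum_seqs G G0)}"

(* A factorization is a multiset of atoms, since factorizations are taken up to order. *)
definition factorization_lengths ::
    "('a, 'b) monoid_scheme \<Rightarrow> 'a set \<Rightarrow> 'a multiset \<Rightarrow> nat set" where
  "factorization_lengths G G0 B =
     {size F | F. set_mset F \<subseteq> min_zero_sum_seqs G G0 \<and> \<Sum>\<^sub># F = B}"

definition successive_distances :: "nat set \<Rightarrow> nat set" where
  "successive_distances L = {l' - l | l l'. l \<in> L \<and> l' \<in> L \<and> l < l' \<and> {l<..<l'} \<inter> L = {}}"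

definition distances :: "('a, 'b) monoid_scheme \<Rightarrow> 'a set \<Rightarrow> nat set" where
  "distances G G0 =
     (\<Union>B\<in>zero_sum_seqs G G0. successive_distances (factorization_lengths G G0 B))"

definition Delta_star :: "('a, 'b) monoid_scheme \<Rightarrow> nat set" where
  "Delta_star G =
     {LEAST d. d \<in> distances G G0 | G0. G0 \<subseteq> carrier G \<and> distances G G0 \<noteq> {}}"

(* The two quotients are rational and n - c1 - c2 may be negative, so no truncation occurs. *)

definition quot1 :: "nat \<Rightarrow> nat \<Rightarrow> nat \<Rightarrow> rat" where
  "quot1 n c1 c2 = (of_nat n - of_nat c1 - of_nat c2) / (of_nat c1 * of_nat c2)"

definition quot2 :: "nat \<Rightarrow> nat \<Rightarrow> nat \<Rightarrow> nat \<Rightarrow> rat" where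
  "quot2 n c1 c2 d = (of_nat n - of_nat c1 - of_nat c2) * of_nat d / (of_nat c2 * of_nat n)"

definition M_set :: "nat \<Rightarrow> (nat \<times> nat \<times> nat) set" where
  "M_set n =
     {(c1, c2, d). c1 \<in> {1..n} \<and> c2 \<in> {1..n} \<and> 0 < d \<and> d dvd n \<and>
        quot1 n c1 c2 \<in> \<nat> - {0} \<and> quot2 n c1 c2 d \<in> \<nat> - {0}}"

definition I_set :: "nat \<Rightarrow> nat set" where
  "I_set n =
     {gcd a b | a b c1 c2 d. (c1, c2, d) \<in> M_set n \<and>
        of_nat a = quot1 n c1 c2 \<and> of_nat b = quot2 n c1 c2 d}"

end

theory Submission
  imports Defs "HOL-Number_Theory.Cong" "HOL-Algebra.Multiplicative_Group"
begin

text \<open>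
  In a cyclic group of prime power order every nonempty set \<open>G0\<close> contains a generator \<open>c\<close> of the subgroup
  it generates, of order \<open>n\<close> say. Discrete logarithms to the base \<open>c\<close> turn \<open>G0\<close> into a set \<open>S\<close> of
  residues in \<open>{1..n}\<close> with \<open>1 \<in> S\<close>. The index of a zero-sum sequence is its sum divided by \<open>n\<close>,
  and \<open>min \<Delta>(G0)\<close> is the gcd \<open>D\<close> of all (index of an atom) \<open>- 1\<close>.

  Only \<open>2 n \<le> D\<^sup>2\<close> is used of the size of \<open>D\<close>. Then a zero-sum sequence of index at most \<open>D\<close> is a
  product of atoms of index one, which is a strong packing condition. It forces \<open>n = q b + r\<close> and
  \<open>b = s + E r\<close> with \<open>D | E\<close> and \<open>s | r\<close> for every \<open>b \<in> S\<close> that does not divide \<open>n\<close>, with the same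
  remainder \<open>r\<close> for all of them. If some \<open>1 \<noteq> a \<in> S\<close> is coprime to \<open>n\<close>, then \<open>a = 1 + E r\<close>, all other
  non-divisors of \<open>n\<close> in \<open>S\<close> are multiples of \<open>a\<close>, and the divisors \<open>d > D\<close> of \<open>n\<close> satisfy
  \<open>n D | (a - 1) d\<close>. For the smallest such \<open>d\<close> this gives \<open>D = gcd E ((a - 1) d / n)\<close>, the value attached
  to \<open>(c1, c2, d) = (r, q, d)\<close>. If there is no such \<open>a\<close>, then all elements of \<open>S\<close> except \<open>1\<close> are
  divisible by \<open>p\<close>, and dividing by \<open>p\<close> leads to a group of order \<open>n / p\<close> with the same indices.
  Conversely \<open>(c1, c2, d)\<close> is realised by \<open>S = {1, a, d}\<close> with \<open>a = 1 + (n - c1 - c2) / c2\<close>.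
\<close>

section \<open>Zero-sum sequences of residues\<close>

definition zero_sum :: "nat \<Rightarrow> nat set \<Rightarrow> nat multiset \<Rightarrow> bool" where
  "zero_sum n S M \<longleftrightarrow> set_mset M \<subseteq> S \<and> n dvd \<Sum>\<^sub># M"

definition atom :: "nat \<Rightarrow> nat set \<Rightarrow> nat multiset \<Rightarrow> bool" where
  "atom n S U \<longleftrightarrow> zero_sum n S U \<and> U \<noteq> {#} \<and> (\<forall>T. T \<subset># U \<and> T \<noteq> {#} \<longrightarrow> \<not> n dvd \<Sum>\<^sub># T)"

text \<open>The index of an atom is its sum divided by \<open>n\<close>.
  \<open>least_distance\<close> identifies this gcd with the minimum distance; it is 0 exactly when
  there are no distances.\<close>

definition min_dist :: "nat \<Rightarrow> nat set \<Rightarrow> nat" where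
  "min_dist n S = Gcd {i - 1 | i U. atom n S U \<and> \<Sum>\<^sub># U = n * i}"

text \<open>An integer form of \<open>D dvd min_dist n S\<close>: it avoids truncated subtraction
  and adds up well along a factorization.\<close>

definition index_one_mod :: "nat \<Rightarrow> nat set \<Rightarrow> nat \<Rightarrow> bool" where
  "index_one_mod n S D \<longleftrightarrow> (\<forall>U i. atom n S U \<longrightarrow> \<Sum>\<^sub># U = n * i \<longrightarrow> int D dvd int i - 1)"

lemma atom_subset_eq:
  assumes "atom n S U" "T \<subseteq># U" "T \<noteq> {#}" "n dvd \<Sum>\<^sub># T"
  shows "T = U"
  using assms unfolding atom_def by (auto simp: subset_mset.le_less)

lemma atomI:
  assumes "zero_sum n S U" "U \<noteq> {#}" "\<And>T. T \<subseteq># U \<Longrightarrow> T \<noteq> {#} \<Longrightarrow> n dvd \<Sum>\<^sub># T \<Longrightarrow> T = U"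
  shows "atom n S U"
  unfolding atom_def
proof (intro conjI allI impI)
  fix T assume "T \<subset># U \<and> T \<noteq> {#}"
  then show "\<not> n dvd \<Sum>\<^sub># T" using assms(3)[of T] by (auto simp: subset_mset.less_le)
qed (use assms in auto)

lemma sum_mset_pos:
  fixes M :: "nat multiset"
  assumes "M \<noteq> {#}" "0 \<notin># M"
  shows "0 < \<Sum>\<^sub># M"
proof -
  have "\<not> (\<forall>x \<in># M. x = 0)" using assms by (metis multiset_nonemptyE)
  then have "\<Sum>\<^sub># M \<noteq> 0" unfolding sum_mset_0_iff .
  then show ?thesis by (rule neq0_conv[THEN iffD1])
qed

lemma subset_eq_sum_eq:
  fixes M T :: "nat multiset"
  assumes "T \<subseteq># M" "0 \<notin># M" "\<Sum>\<^sub># M \<le> \<Sum>\<^sub># T"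
  shows "T = M"
proof -
  obtain R where R: "M = T + R" using assms(1) by (metis subset_mset.le_iff_add)
  have "\<Sum>\<^sub># R = 0" using assms(3) unfolding R by simp
  moreover have "0 \<notin># R" using assms(2) unfolding R by simp
  ultimately have "R = {#}" using sum_mset_pos[of R] by (metis less_irrefl)
  then show ?thesis using R by simp
qed

lemma sum_mset_dvd:
  fixes M :: "nat multiset"
  shows "(\<And>x. x \<in># M \<Longrightarrow> d dvd x) \<Longrightarrow> d dvd \<Sum>\<^sub># M"
  by (induction M) auto

lemma sum_mset_mono_subset:
  fixes M T :: "nat multiset"
  shows "T \<subseteq># M \<Longrightarrow> \<Sum>\<^sub># T \<le> \<Sum>\<^sub># M"
  by (metis le_add1 subset_mset.le_iff_add sum_mset.union)

lemma atom_index: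
  assumes "atom n S U" "0 < n" "0 \<notin> S"
  obtains i where "\<Sum>\<^sub># U = n * i" "0 < i"
proof -
  have "0 \<notin># U" "U \<noteq> {#}" using assms unfolding atom_def zero_sum_def by auto
  then have "0 < \<Sum>\<^sub># U" by (rule sum_mset_pos[rotated])
  moreover obtain i where "\<Sum>\<^sub># U = n * i" using assms(1) unfolding atom_def zero_sum_def dvd_def by blast
  ultimately show ?thesis using that by auto
qed

text \<open>Without 0 in \<open>S\<close> every atom has index at least one, so the natural number
  \<open>i - 1\<close> agrees with the integer difference.\<close>

lemma dvd_min_dist_iff:
  assumes "0 < n" "0 \<notin> S"
  shows "D dvd min_dist n S \<longleftrightarrow> index_one_mod n S D"
proof -
  have *: "D dvd i - 1 \<longleftrightarrow> int D dvd int i - 1" if "atom n S U" "\<Sum>\<^sub># U = n * i" for U i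
  proof -
    have "0 < i" using atom_index[OF that(1) assms] that(2) assms(1) by (metis mult_cancel1 not_gr0)
    then show ?thesis
      by (metis One_nat_def Suc_leI of_nat_1 of_nat_diff of_nat_dvd_iff)
  qed
  have "D dvd min_dist n S \<longleftrightarrow> (\<forall>U i. atom n S U \<longrightarrow> \<Sum>\<^sub># U = n * i \<longrightarrow> D dvd i - 1)"
    unfolding min_dist_def dvd_Gcd_iff by blast
  then show ?thesis unfolding index_one_mod_def using * by blast
qed

lemma atom_below:
  assumes "zero_sum n S M" "M \<noteq> {#}"
  obtains U where "atom n S U" "U \<subseteq># M"
  using assms
proof (induction "size M" arbitrary: M thesis rule: less_induct)
  case less
  show ?case
  proof (cases "atom n S M")
    case True
    then show ?thesis using less.prems(1) by blast
  next
    case False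
    then obtain T where T: "T \<subset># M" "T \<noteq> {#}" "n dvd \<Sum>\<^sub># T"
      using less.prems unfolding atom_def by blast
    have "zero_sum n S T" using T less.prems(2) unfolding zero_sum_def
      by (meson mset_subset_eqD subset_iff subset_mset.less_imp_le)
    with less.hyps[of T] T obtain U where "atom n S U" "U \<subseteq># T"
      using mset_subset_size by blast
    then show ?thesis using less.prems(1) T by (meson subset_mset.dual_order.trans subset_mset.less_imp_le)
  qed
qed

lemma zero_sum_diff:
  assumes "zero_sum n S M" "U \<subseteq># M" "n dvd \<Sum>\<^sub># U"
  shows "zero_sum n S (M - U)"
proof -
  obtain R where R: "M = U + R" using assms(2) by (metis subset_mset.le_iff_add)
  then show ?thesis using assms unfolding zero_sum_def by (auto simp: dvd_add_right_iff)
qed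

text \<open>Splitting off an atom shrinks the sequence, so induction on the size becomes induction
  along a factorization.\<close>

lemma zero_sum_induct [consumes 1, case_names empty add]:
  assumes "zero_sum n S M" "P {#}" 
    "\<And>U R. atom n S U \<Longrightarrow> zero_sum n S R \<Longrightarrow> P R \<Longrightarrow> P (U + R)"
  shows "P M"
  using assms(1)
proof (induction "size M" arbitrary: M rule: less_induct)
  case less
  show ?case
  proof (cases "M = {#}")
    case False
    then obtain U where U: "atom n S U" "U \<subseteq># M" using atom_below[OF less.prems] by blast
    have z: "zero_sum n S (M - U)" using zero_sum_diff[OF less.prems U(2)] U(1) unfolding atom_def zero_sum_def by blast
    have "U \<noteq> {#}" using U(1) unfolding atom_def by blast
    then have "size (M - U) < size M"
      by (metis U(2) add_diff_cancel_left' mset_subset_size nonempty_has_size size_Diff_submset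
          size_mset_mono subset_mset.add_diff_inverse subset_mset.diff_add zero_less_diff diff_less less_le_trans)
    then have "P (M - U)" using less.hyps z by blast
    then have "P (U + (M - U))" using assms(3) U(1) z by blast
    then show ?thesis using U(2) by simp
  qed (use assms(2) in simp)
qed

text \<open>By additivity \<open>f M\<close> is the sum of the values on the atoms of a
  factorization, so one of these values is positive. It serves to extract an atom of positive
  excess.\<close>

lemma atom_positive:
  fixes f :: "nat multiset \<Rightarrow> int"
  assumes "zero_sum n S M" "\<And>A B. f (A + B) = f A + f B" "0 < f M"
  obtains U where "atom n S U" "U \<subseteq># M" "0 < f U"
proof -
  have f0: "f {#} = 0" using assms(2)[of "{#}" "{#}"] by simp
  have "0 < f M \<longrightarrow> (\<exists>U. atom n S U \<and> U \<subseteq># M \<and> 0 < f U)"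
    using assms(1)
  proof (induction rule: zero_sum_induct)
    case (add U R)
    show ?case
    proof (cases "0 < f U")
      case True
      then show ?thesis using add by (intro impI exI[of _ U]) auto
    next
      case False
      show ?thesis
      proof
        assume "0 < f (U + R)"
        then have "0 < f R" using False assms(2)[of U R] by simp
        then obtain V where "atom n S V \<and> V \<subseteq># R \<and> 0 < f V" using add by blast
        then show "\<exists>V. atom n S V \<and> V \<subseteq># U + R \<and> 0 < f V"
          by (metis mset_subset_eq_add_right subset_mset.order_trans)
      qed
    qed
  qed (use f0 in simp)
  then show ?thesis using that assms(3) by blast
qed

section \<open>Factorizations and their total index\<close>

lemma factorization_ex:
  assumes "zero_sum n S M"
  obtains F where "set_mset F \<subseteq> Collect (atom n S)" "\<Sum>\<^sub># F = M"
proof -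
  have "\<exists>F. set_mset F \<subseteq> Collect (atom n S) \<and> \<Sum>\<^sub># F = M"
    using assms
  proof (induction rule: zero_sum_induct)
    case empty
    then show ?case by (intro exI[of _ "{#}"]) auto
  next
    case (add U R)
    then obtain F where "set_mset F \<subseteq> Collect (atom n S) \<and> \<Sum>\<^sub># F = R" by blast
    then show ?case using add by (intro exI[of _ "add_mset U F"]) auto
  qed
  then show ?thesis using that by blast
qed

text \<open>Indices add up over the atoms of \<open>F\<close>, and each of them is positive and 1
  modulo \<open>D\<close>.\<close>

lemma factorization_index:
  assumes "set_mset F \<subseteq> Collect (atom n S)" "0 < n" "0 \<notin> S" "index_one_mod n S D"
  obtains i where "\<Sum>\<^sub># (\<Sum>\<^sub># F) = n * i" "size F \<le> i" "int D dvd int i - int (size F)"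
proof -
  have "\<exists>i. \<Sum>\<^sub># (\<Sum>\<^sub># F) = n * i \<and> size F \<le> i \<and> int D dvd int i - int (size F)"
    using assms(1)
  proof (induction F)
    case (add U F)
    then obtain i where i: "\<Sum>\<^sub># (\<Sum>\<^sub># F) = n * i" "size F \<le> i" "int D dvd int i - int (size F)"
      by auto
    have U: "atom n S U" using add by auto
    then obtain j where j: "\<Sum>\<^sub># U = n * j" "0 < j" using atom_index assms by blast
    then have "int D dvd int j - 1" using assms(4) U unfolding index_one_mod_def by blast
    then have "int D dvd (int i - int (size F)) + (int j - 1)" using i by (intro dvd_add)
    then show ?case using i j by (intro exI[of _ "i + j"]) (auto simp: algebra_simps)
  qed auto
  then show ?thesis using that by blast
qed

text \<open>The length of a factorization is at most the index of the product and congruent to it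
  modulo \<open>D\<close>, so up to index \<open>D\<close> all atoms have index one.\<close>

lemma count_le_of_small_index:
  assumes good: "index_one_mod n S D" and n: "0 < n" "0 \<notin> S"
    and M: "zero_sum n S M" "\<Sum>\<^sub># M = n * i" "i \<le> D"
    and c: "\<And>V. V \<subseteq># M \<Longrightarrow> \<Sum>\<^sub># V = n \<Longrightarrow> count V a \<le> c"
  shows "count M a \<le> c * i"
proof (cases "M = {#}")
  case False
  obtain F where F: "set_mset F \<subseteq> Collect (atom n S)" "\<Sum>\<^sub># F = M" using factorization_ex M(1) by blast
  obtain i' where i': "\<Sum>\<^sub># (\<Sum>\<^sub># F) = n * i'" "size F \<le> i'" "int D dvd int i' - int (size F)"
    using factorization_index F n good by blast
  have ii: "i' = i" using i' F M n by simp
  have "F \<noteq> {#}" using F False by auto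
  then have "0 < size F" by (simp add: nonempty_has_size)
  then have "int i - int (size F) < int D" using M by linarith
  moreover have "0 \<le> int i - int (size F)" using i' ii by simp
  ultimately have "int i - int (size F) = 0" using i'(3) ii
    by (cases "int i - int (size F) = 0") (auto dest: zdvd_imp_le)
  then have si: "size F = i" by simp
  \<comment> \<open>The indices of the \<open>size F = i\<close> atoms are positive and add up to
    \<open>i\<close>, so each is one.\<close>
  have "\<Sum>\<^sub># U = n" if "U \<in># F" for U
  proof -
    from that obtain F' where F': "F = add_mset U F'" by (rule mset_add)
    have "atom n S U" using F F' by auto
    then obtain j where j: "\<Sum>\<^sub># U = n * j" "0 < j" using atom_index n by blast
    obtain j' where j': "\<Sum>\<^sub># (\<Sum>\<^sub># F') = n * j'" "size F' \<le> j'"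
      using factorization_index[of F' n S D] F F' n good by auto
    have "M = U + \<Sum>\<^sub># F'" using F F' by simp
    then have "\<Sum>\<^sub># M = n * j + n * j'" using j j' by simp
    then have "n * (j + j') = n * i" using M by (simp add: algebra_simps)
    then have "j + j' = i" using n by simp
    then have "j = 1" using j j' si F' by simp
    then show ?thesis using j by simp
  qed
  moreover have "U \<subseteq># M" if "U \<in># F" for U
    using that F(2) by (auto dest!: multi_member_split)
  ultimately have le: "count U a \<le> c" if "U \<in># F" for U using c that by blast
  have "count (\<Sum>\<^sub># F) a \<le> c * size F" using le
    by (induction F) (auto simp: algebra_simps add_mono)
  then show ?thesis using F si by simp
qed simp

section \<open>Explicit sums and subset sums\<close>

lemma sum_two:
  fixes M :: "nat multiset"
  assumes "set_mset M \<subseteq> {a, b}" "a \<noteq> b"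
  shows "\<Sum>\<^sub># M = count M a * a + count M b * b"
  using assms(1)
proof (induction M)
  case (add x M)
  then show ?case using assms(2) by auto
qed auto

lemma sum_three:
  fixes M :: "nat multiset"
  assumes "set_mset M \<subseteq> {a, b, c}" "a \<noteq> b" "a \<noteq> c" "b \<noteq> c"
  shows "\<Sum>\<^sub># M = count M a * a + count M b * b + count M c * c"
  using assms(1)
proof (induction M)
  case (add x M)
  then show ?case using assms(2-) by auto
qed auto

text \<open>Removing a minimal element keeps all remaining sums divisible by it, so the greedy choice
  hits the target exactly.\<close>

lemma chain_subset_sum:
  fixes M :: "nat multiset"
  assumes "\<And>x y. x \<in># M \<Longrightarrow> y \<in># M \<Longrightarrow> x dvd y \<or> y dvd x"
    and "\<And>x. x \<in># M \<Longrightarrow> x dvd t" and "t \<le> \<Sum>\<^sub># M"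
  obtains T where "T \<subseteq># M" "\<Sum>\<^sub># T = t"
proof -
  have "\<exists>T. T \<subseteq># M \<and> \<Sum>\<^sub># T = t"
    using assms
  proof (induction "size M" arbitrary: M)
    case 0
    then show ?case by auto
  next
    case (Suc k)
    show ?case
    proof (cases "0 \<in># M")
      case True
      then show ?thesis using Suc(4)[of 0] by (intro exI[of _ "{#}"]) auto
    next
      case False
      define m where "m = Min (set_mset M)"
      have "M \<noteq> {#}" using Suc(2) by auto
      then have m: "m \<in># M" "\<And>x. x \<in># M \<Longrightarrow> m \<le> x" unfolding m_def by auto
      have md: "m dvd x" if "x \<in># M" for x
        using Suc(3)[OF m(1) that] m(2)[OF that] dvd_imp_le[of x m] False m(1)
        by (metis antisym bot_nat_0.not_eq_extremum dvd_refl)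
        obtain R where R: "M = add_mset m R" using m(1) by (rule mset_add)
      show ?thesis
      proof (cases "t \<le> \<Sum>\<^sub># R")
        case True
        then obtain T where "T \<subseteq># R \<and> \<Sum>\<^sub># T = t"
          using Suc(1)[of R] Suc R by (metis size_add_mset nat.inject union_iff insert_iff set_mset_add_mset_insert)
        then show ?thesis using R by (metis add_mset_add_single mset_subset_eq_add_left subset_mset.order_trans)
      next
        case False
        have "m dvd \<Sum>\<^sub># R" using md R
          by (intro sum_mset_dvd) auto
        moreover have "m dvd t" using Suc(4) m by blast
        ultimately have "m \<le> t - \<Sum>\<^sub># R" using False by (intro dvd_imp_le) (auto intro: dvd_diff_nat)
        then have "\<Sum>\<^sub># M = t" using R Suc(5) False by simp
        then show ?thesis by blast
      qed
    qed
  qed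
  then show ?thesis using that by blast
qed

section \<open>One residue that does not divide the modulus\<close>

text \<open>The class of zero is represented by \<open>n\<close>, so all terms are positive.
  \<open>D\<close> is assumed only to divide every index of an atom minus one; the application takes
  the gcd itself.\<close>

locale large_gap =
  fixes n :: nat and S :: "nat set" and D :: nat
  assumes n_pos: "0 < n" and S_sub: "S \<subseteq> {1..n}" and one_in: "1 \<in> S"
    and good_D: "index_one_mod n S D" and D_large: "2 * n \<le> D * D"
begin

lemma zero_notin: "0 \<notin> S"
  using S_sub by auto

lemma D_ge2: "2 \<le> D"
proof (rule ccontr)
  assume "\<not> 2 \<le> D"
  then have "D * D \<le> 1 * 1" by (intro mult_le_mono) auto
  then show False using D_large n_pos by simp
qed

text \<open>A sequence of index \<open>i\<close> consisting of \<open>x\<close> ones and \<open>y\<close> copies of \<open>b\<close> has the coordinates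
  \<open>j = y - q i\<close> and \<open>v = i - E j\<close>, in which \<open>x = v r - j s\<close>.\<close>

lemma atom_two_dvd:
  fixes b q r s E v0 j0 x0 :: nat
  assumes b: "b \<in> S" "b \<noteq> 1" and nq: "n = q * b + r" and bs: "b = s + E * r"
    and pos: "0 < r" "0 < s" "0 < v0" and x0: "j0 * s + x0 = v0 * r" "x0 < r"
    and min: "\<And>v j. 1 \<le> v \<Longrightarrow> 1 \<le> j \<Longrightarrow> j * s \<le> v * r \<Longrightarrow> v * r \<le> j * s + x0
                 \<Longrightarrow> v0 + E * j0 \<le> v + E * j"
  shows "int D dvd int (v0 + E * j0) - 1"
proof -
  define i0 where "i0 = v0 + E * j0"
  define M where "M = replicate_mset x0 1 + replicate_mset (q * i0 + j0) b"
  have "x0 + j0 * b = r * i0"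
    unfolding i0_def bs using x0 by (simp add: algebra_simps)
  then have sumM: "\<Sum>\<^sub># M = n * i0" unfolding M_def nq by (simp add: algebra_simps)
  have i0: "0 < i0" using pos unfolding i0_def by simp
  have setM: "set_mset M \<subseteq> {1, b}" unfolding M_def by (auto split: if_splits)
  have zeroM: "0 \<notin># M" using setM b zero_notin by auto
  have cM: "count M 1 = x0" "count M b = q * i0 + j0" using b unfolding M_def by auto
  have "atom n S M"
  proof (rule atomI)
    show "zero_sum n S M" unfolding zero_sum_def using setM sumM b one_in by auto
    show "M \<noteq> {#}" using sumM i0 n_pos by auto
    fix T assume T: "T \<subseteq># M" "T \<noteq> {#}" "n dvd \<Sum>\<^sub># T"
    have zT: "0 \<notin># T" using T zeroM by (meson mset_subset_eqD)
    obtain i where i: "\<Sum>\<^sub># T = n * i" using T(3) by (elim dvdE)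
    have i1: "1 \<le> i" using sum_mset_pos[OF T(2) zT] i by (cases i) auto
    have sT: "set_mset T \<subseteq> {1, b}" using T setM by (meson mset_subset_eqD subset_iff)
    have eq: "count T 1 + count T b * b = n * i" using sum_two[OF sT] b i by simp
    have x: "count T 1 \<le> x0" using T(1) cM by (metis mset_subset_eq_count)
    define j where "j = int (count T b) - int q * int i"
    define v where "v = int i - int E * j"
    have xv: "int (count T 1) = v * int r - j * int s"
    proof -
      have "int (count T 1) + int (count T b) * int b = int n * int i"
        using eq by (metis of_nat_add of_nat_mult)
      then show ?thesis unfolding j_def v_def using nq bs by (simp add: algebra_simps)
    qed
    \<comment> \<open>For \<open>j \<le> 0\<close> one gets \<open>v \<ge> 1\<close> and hence at
      least \<open>r\<close> ones, while only \<open>x0 < r\<close> are available.\<close>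
    have j1: "1 \<le> j"
    proof (rule ccontr)
      assume "\<not> 1 \<le> j"
      then have "j \<le> 0" by simp
      then have "int E * j \<le> 0" "j * int s \<le> 0" by (auto intro: mult_nonneg_nonpos mult_nonpos_nonneg)
      then have "1 \<le> v" using i1 unfolding v_def by simp
      then have "1 * int r \<le> v * int r" by (intro mult_right_mono) auto
      then have "int r \<le> int (count T 1)" using xv \<open>j * int s \<le> 0\<close> by simp
      then show False using x x0 by simp
    qed
    have v1: "1 \<le> v"
    proof (rule ccontr)
      assume "\<not> 1 \<le> v"
      then have "v * int r \<le> 0" by (intro mult_nonpos_nonneg) auto
      moreover have "0 < j * int s" using j1 pos by simp
      ultimately show False using xv by simp
    qed
    have vj: "int (nat v) = v" "int (nat j) = j" using v1 j1 by auto
    have 1: "nat j * s \<le> nat v * r" 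
      unfolding of_nat_le_iff[where 'a=int, symmetric] using xv vj by simp
    have 2: "nat v * r \<le> nat j * s + x0"
      unfolding of_nat_le_iff[where 'a=int, symmetric] using xv vj x by simp
    \<comment> \<open>By \<open>min\<close> no nonempty zero-sum subsequence has index below
      \<open>i0\<close>, so \<open>T\<close> already has the full sum.\<close>
    have "i0 \<le> nat v + E * nat j" unfolding i0_def by (rule min) (use v1 j1 1 2 in auto)
    moreover have "nat v + E * nat j = i"
      unfolding of_nat_eq_iff[where 'a=int, symmetric] using vj by (simp add: v_def)
    ultimately have "\<Sum>\<^sub># M \<le> \<Sum>\<^sub># T" using sumM i by simp
    then show "T = M" using subset_eq_sum_eq[OF T(1) zeroM] by simp
  qed
  then show ?thesis using good_D sumM unfolding index_one_mod_def i0_def by blast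
qed

text \<open>The pair \<open>v = j = 1\<close> gives an atom of index \<open>1 + E\<close>, so
  \<open>D\<close> divides \<open>E\<close>. If \<open>s\<close> did not divide \<open>r\<close>, a
  second atom would give \<open>D \<le> k - 1 < r\<close>, and then
  \<open>D * D \<le> E * r < n\<close> contradicts \<open>D_large\<close>.\<close>

lemma nondivisor_form:
  assumes b: "b \<in> S" "\<not> b dvd n"
  obtains s E where "b = s + E * (n mod b)" "D dvd E" "0 < E" "0 < s" "s dvd n mod b"
proof -
  define q where "q = n div b"
  define r where "r = n mod b"
  have nq: "n = q * b + r" unfolding q_def r_def by simp
  have r0: "0 < r" using b unfolding r_def by (simp add: dvd_eq_mod_eq_0)
  have b0: "0 < b" using b zero_notin by (cases b) auto
  have rb: "r < b" unfolding r_def using b0 by simp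
  have b1: "b \<noteq> 1" using b by auto
  have bn: "b \<le> n" using b S_sub by auto
  define E where "E = (b - 1) div r"
  define s where "s = (b - 1) mod r + 1"
  have bs: "b = s + E * r" unfolding E_def s_def using b0 by simp
  have sr: "s \<le> r" unfolding s_def using r0 by (simp add: Suc_le_eq)
  have s0: "0 < s" unfolding s_def by simp
  have E0: "0 < E" unfolding E_def using rb r0 by (simp add: div_greater_zero_iff)
  have "int D dvd int (1 + E * 1) - 1"
  proof (rule atom_two_dvd[OF b(1) b1 nq bs r0 s0])
    show "1 * s + (r - s) = 1 * r" using sr by simp
    show "r - s < r" using s0 r0 by simp
    show "1 + E * 1 \<le> v + E * j" if "1 \<le> v" "1 \<le> j" for v j
      using that by (intro add_mono mult_left_mono) auto
  qed simp
  then have DE: "D dvd E" by simp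
  have "s dvd r"
  proof (rule ccontr)
    assume ns: "\<not> s dvd r"
    define t where "t = r mod s"
    define j0 where "j0 = r div s"
    have t: "0 < t" "t < s" using ns s0 unfolding t_def by (auto simp: dvd_eq_mod_eq_0)
    have rt: "r = j0 * s + t" unfolding t_def j0_def by simp
    \<comment> \<open>\<open>k\<close> is \<open>s / t\<close> rounded up. As \<open>v * r\<close>
      exceeds \<open>v * j0 * s\<close> by \<open>v * t\<close>, it is the first \<open>v\<close>
      for which \<open>(v * j0 + 1) * s\<close> does not exceed \<open>v * r\<close>.\<close>
    define k where "k = (s - 1) div t + 1"
    have k_le: "s \<le> k * t"
    proof -
      have "s - 1 < t * ((s - 1) div t) + t" using t by (metis dividend_less_times_div add.commute)
      then show ?thesis unfolding k_def by (simp add: algebra_simps)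
    qed
    have k_lt: "(k - 1) * t < s"
    proof -
      have "k - 1 = (s - 1) div t" unfolding k_def by simp
      then have "(k - 1) * t \<le> s - 1" by (simp only: div_times_less_eq_dividend)
      then show ?thesis using s0 by linarith
    qed
    have k2: "2 \<le> k"
    proof -
      have "t \<le> s - 1" using t by simp
      then have "1 \<le> (s - 1) div t" using t by (simp add: div_greater_zero_iff Suc_le_eq)
      then show ?thesis unfolding k_def by simp
    qed
    have kt: "k * t < s + t"
    proof -
      have "k * t = (k - 1) * t + t" using k2 by (cases k) auto
      then show ?thesis using k_lt by simp
    qed
    have "int D dvd int (k + E * (k * j0 + 1)) - 1"
    proof (rule atom_two_dvd[OF b(1) b1 nq bs r0 s0])
      show "0 < k" using k2 by simp
      show "(k * j0 + 1) * s + (k * t - s) = k * r" using k_le by (simp add: rt algebra_simps)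
      show "k * t - s < r" using kt t rt sr by linarith
      fix v j :: nat
      assume v: "1 \<le> v" "1 \<le> j" "j * s \<le> v * r" "v * r \<le> j * s + (k * t - s)"
      have lt: "v * r < j * s + t" using v kt k_le by linarith
      \<comment> \<open>A smaller \<open>j\<close> would require at least
        \<open>v * t \<ge> t\<close> ones, but fewer than \<open>t\<close> are available.\<close>
      have "v * j0 < j"
      proof (rule ccontr)
        assume "\<not> v * j0 < j"
        then have "j * s \<le> v * j0 * s" by (intro mult_right_mono) auto
        moreover have "v * r = v * j0 * s + v * t" by (simp add: rt algebra_simps)
        moreover have "1 * t \<le> v * t" using v by (intro mult_right_mono) auto
        ultimately show False using lt by linarith
      qed
      then have "(v * j0 + 1) * s \<le> j * s" by (intro mult_right_mono) auto
      then have "v * j0 * s + s \<le> j * s" by (simp add: algebra_simps)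
      moreover have vr: "v * r = v * j0 * s + v * t" by (simp add: rt algebra_simps)
      ultimately have "s \<le> v * t" using v(3) by linarith
      then have "(k - 1) * t < v * t" using k_lt by linarith
      then have "k - 1 < v" by simp
      then have kv: "k \<le> v" by linarith
      have "k * j0 + 1 \<le> v * j0 + 1" using kv by simp
      also have "\<dots> \<le> j" using \<open>v * j0 < j\<close> by simp
      finally show "k + E * (k * j0 + 1) \<le> v + E * j" using kv by (intro add_mono mult_left_mono) auto
    qed
    moreover have "int D dvd int (E * (k * j0 + 1))" using DE by simp
    ultimately have "int D dvd (int (k + E * (k * j0 + 1)) - 1) - int (E * (k * j0 + 1))"
      by (rule dvd_diff)
    then have "int D dvd int (k - 1)" using k2 by (simp add: of_nat_diff)
    then have "D dvd k - 1" by (simp only: of_nat_dvd_iff)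
    then have "D \<le> k - 1" using k2 by (intro dvd_imp_le) auto
    also have "\<dots> \<le> (k - 1) * t" using t by simp
    also have "\<dots> \<le> r" using k_lt sr by simp
    finally have "D \<le> r" .
    moreover have "D \<le> E" using DE E0 by (rule dvd_imp_le)
    ultimately have "D * D \<le> E * r" by (intro mult_le_mono) auto
    also have "\<dots> < n" using bs s0 bn by simp
    finally show False using D_large by simp
  qed
  then show ?thesis using that[of s E] bs DE E0 s0 unfolding r_def by blast
qed

end

section \<open>Two residues that do not divide the modulus\<close>

context large_gap
begin

text \<open>With \<open>E = D * e\<close> and \<open>B = e * r\<close> one has
  \<open>n > D * B * q \<ge> D * r * q\<close>, so \<open>2 * n \<le> D * D\<close> yields
  \<open>2 * r * q < D\<close>. Thus \<open>s * q + r\<close> and \<open>B * q\<close> are the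
  remainder and the quotient of \<open>n\<close> by \<open>D\<close>, a fact that links different
  non-divisors.\<close>

lemma nondivisor_bounds:
  assumes b: "b \<in> S" "\<not> b dvd n"
  defines "q \<equiv> n div b" and "r \<equiv> n mod b"
  obtains s B where "b = s + D * B" "0 < s" "s dvd r" "s \<le> r" "0 < r" "r dvd B" "0 < B" "0 < q"
    "2 * r * q < D" "2 * r < D" "s * q + r < D" "n = q * b + r" "n = (s * q + r) + D * (B * q)"
    "b \<noteq> 1"
proof -
  obtain s E where sE: "b = s + E * r" "D dvd E" "0 < E" "0 < s" "s dvd r"
    using nondivisor_form[OF b] unfolding r_def by blast
  obtain e where e: "E = D * e" using sE(2) by (elim dvdE)
  have e0: "0 < e" using sE(3) e by (cases e) auto
  define B where "B = e * r"
  have bB: "b = s + D * B" using sE(1) unfolding e B_def by simp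
  have nq: "n = q * b + r" unfolding q_def r_def by simp
  have r0: "0 < r" using b unfolding r_def by (simp add: dvd_eq_mod_eq_0)
  have sr: "s \<le> r" using sE(5) r0 by (rule dvd_imp_le)
  have b0: "0 < b" "b \<le> n" using b S_sub by auto
  have q0: "0 < q" unfolding q_def using b0 by (simp add: div_greater_zero_iff)
  have nB: "n = (s * q + r) + D * (B * q)" using nq bB by (simp add: algebra_simps)
  have rB: "r \<le> B" unfolding B_def using e0 by simp
  have "D * (r * q) \<le> D * (B * q)" using rB by simp
  also have "\<dots> < n" using nB r0 by simp
  finally have "2 * (D * (r * q)) < D * D" using D_large by linarith
  then have "D * (2 * r * q) < D * D" by (simp add: algebra_simps)
  then have 2: "2 * r * q < D" by (metis mult_less_cancel1)
  have rq: "r \<le> r * q" using q0 by simp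
  have 3: "s * q + r < D"
  proof -
    have "s * q \<le> r * q" using sr by simp
    moreover have "2 * r * q = r * q + r * q" by simp
    ultimately show ?thesis using rq 2 by linarith
  qed
  have 4: "2 * r < D"
  proof -
    have "2 * r * q = 2 * (r * q)" by simp
    then show ?thesis using rq 2 by linarith
  qed
  show ?thesis
    by (rule that[of s B]) (use bB sE sr r0 rB 2 3 4 nq nB q0 b e0 in \<open>auto simp: B_def\<close>)
qed

text \<open>
  Let \<open>q1 = B' \<sigma>\<close> and \<open>q2 = A' \<sigma>\<close> with \<open>A', B'\<close> coprime. A sequence of index \<open>i\<close> with \<open>y\<close> copies of \<open>a\<close> and
  \<open>z\<close> copies of \<open>b\<close> has excess \<open>A' y + B' z - A' B' \<sigma> i\<close> (below, \<open>ex\<close> is \<open>n\<close> times the excess). A positive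
  excess needs index at least \<open>l / r2\<close>, so the least such index is that of an atom and equals
  \<open>1 + D \<omega>\<close>. If \<open>r1 < r2\<close>, there is a sequence of index \<open>1 + D \<omega> + \<tau>\<close> and excess one which contains too
  many copies of \<open>a\<close> to be the product of an atom of index \<open>1 + D \<omega>\<close> and \<open>\<tau>\<close> atoms of index one.
\<close>

lemma mod_nondivisors_not_less:
  assumes a: "a \<in> S" "\<not> a dvd n" and b: "b \<in> S" "\<not> b dvd n"
  shows "\<not> n mod a < n mod b"
proof
  assume less: "n mod a < n mod b"
  define q1 r1 q2 r2 where qr: "q1 = n div a" "r1 = n mod a" "q2 = n div b" "r2 = n mod b"
  obtain s1 A where A: "a = s1 + D * A" "0 < s1" "s1 dvd r1" "s1 \<le> r1" "0 < r1" "r1 dvd A" "0 < A"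
    "0 < q1" "2 * r1 * q1 < D" "2 * r1 < D" "s1 * q1 + r1 < D" "n = q1 * a + r1"
    "n = (s1 * q1 + r1) + D * (A * q1)" "a \<noteq> 1"
    using nondivisor_bounds[OF a] unfolding qr by blast
  obtain s2 B where B: "b = s2 + D * B" "0 < s2" "s2 dvd r2" "s2 \<le> r2" "0 < r2" "r2 dvd B" "0 < B"
    "0 < q2" "2 * r2 * q2 < D" "2 * r2 < D" "s2 * q2 + r2 < D" "n = q2 * b + r2"
    "n = (s2 * q2 + r2) + D * (B * q2)" "b \<noteq> 1"
    using nondivisor_bounds[OF b] unfolding qr by blast
  \<comment> \<open>Both decompositions of \<open>n\<close> are divisions by \<open>D\<close>, so
    their quotients agree.\<close>
  have "(s1 * q1 + r1 + D * (A * q1)) div D = A * q1" using A(11) D_ge2 by simp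
  then have nA: "n div D = A * q1" unfolding A(13)[symmetric] .
  have "(s2 * q2 + r2 + D * (B * q2)) div D = B * q2" using B(11) D_ge2 by simp
  then have nB: "n div D = B * q2" unfolding B(13)[symmetric] .
  have AB: "A * q1 = B * q2" using nA nB by simp
  define \<sigma> where "\<sigma> = gcd q1 q2"
  have s0: "0 < \<sigma>" unfolding \<sigma>_def using A by simp
  obtain B' A' where q1: "q1 = B' * \<sigma>" and q2: "q2 = A' * \<sigma>" and cop: "coprime B' A'"
    using gcd_coprime_exists[of q1 q2] s0 unfolding \<sigma>_def by auto
  have A'0: "0 < A'" and B'0: "0 < B'" using A(8) B(8) q1 q2 by auto
  have "A * B' = B * A'" using AB s0 unfolding q1 q2 by simp
  then have "B' dvd B * A'" by (metis dvd_triv_right)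
  then have "B' dvd B" using cop by (simp add: coprime_dvd_mult_left_iff)
  then obtain w where w: "B = w * B'" by (metis dvd_def mult.commute)
  have w0: "0 < w" using B(7) w by (cases w) auto
  \<comment> \<open>Exchanging \<open>A'\<close> copies of \<open>b\<close> for \<open>B'\<close>
    copies of \<open>a\<close> preserves the excess and costs \<open>\<tau>\<close> ones.\<close>
  define \<tau> where "\<tau> = int B' * int a - int A' * int b"
  have st: "int \<sigma> * \<tau> = int r2 - int r1"
  proof -
    have "int n = int q1 * int a + int r1" "int n = int q2 * int b + int r2"
      using A(12) B(12) by (metis of_nat_add of_nat_mult)+
    then show ?thesis unfolding \<tau>_def q1 q2 by (simp add: algebra_simps)
  qed
  have t0: "0 < \<tau>" using st less s0 unfolding qr by (metis diff_gt_0_iff_gt of_nat_0_less_iff of_nat_less_iff zero_less_mult_pos)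
  have tr: "\<tau> < int r2"
  proof -
    have "1 * \<tau> \<le> int \<sigma> * \<tau>" using s0 t0 by (intro mult_right_mono) auto
    then show ?thesis using st A(5) by simp
  qed
  \<comment> \<open>The aim is a solution of \<open>A' * y0 - B' * z0 = 1\<close> with
    \<open>0 \<le> y0 < B'\<close>. Here \<open>z0\<close> is an integer, as it equals
    \<open>-1\<close> if \<open>y0 = 0\<close>.\<close>
  obtain y1 where "[A' * y1 = 1] (mod B')" using cong_solve_coprime_nat[of A' B'] cop by (auto simp: coprime_commute)
  define y0 where "y0 = y1 mod B'"
  have y0B: "y0 < B'" unfolding y0_def using B'0 by simp
  have "[A' * y0 = 1] (mod B')" using \<open>[A' * y1 = 1] (mod B')\<close> unfolding y0_def
    by (simp add: cong_def mod_mult_right_eq)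
  then have "int B' dvd int A' * int y0 - 1"
    by (metis cong_iff_dvd_diff cong_int_iff of_nat_1 of_nat_mult)
  then obtain z0 where z0: "int A' * int y0 - 1 = int B' * z0" by (elim dvdE)
  have z0A: "z0 < int A'"
  proof -
    have "int A' * int y0 < int A' * int B'" using A'0 y0B by simp
    then have "int B' * z0 < int B' * int A'" using z0 by (simp add: algebra_simps)
    then show ?thesis using B'0 by simp
  qed
  \<comment> \<open>With \<open>y0\<close> copies of \<open>a\<close> and
    \<open>A' * \<sigma> * i - z0\<close> copies of \<open>b\<close>, index \<open>i\<close> and
    excess one leave \<open>r2 * i - l\<close> ones.\<close>
  define l where "l = int a * int y0 - int b * z0"
  have l: "int B' * l = int b + \<tau> * int y0"
  proof -
    have "int B' * l = int B' * int a * int y0 - int b * (int B' * z0)"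
      unfolding l_def by (simp add: algebra_simps)
    then show ?thesis unfolding z0[symmetric] \<tau>_def by (simp add: algebra_simps)
  qed
  define e where "e = l - int D * int w"
  have bw: "int b = int s2 + int D * int w * int B'" using B(1) w by simp
  have e: "int B' * e = int s2 + \<tau> * int y0" using l bw unfolding e_def by (simp add: algebra_simps)
  have e0: "0 < e"
  proof -
    have "0 < int s2 + \<tau> * int y0" using B(2) t0 by (simp add: add_pos_nonneg)
    then show ?thesis using e B'0 by (metis of_nat_0_less_iff zero_less_mult_pos)
  qed
  have eD: "e < int D"
  proof -
    have "\<tau> * int y0 \<le> \<tau> * int B'" using t0 y0B by simp
    moreover have "int s2 * 1 \<le> int s2 * int B'" using B'0 by (intro mult_left_mono) auto
    ultimately have "int B' * e \<le> int B' * (int s2 + \<tau>)" using e by (simp add: algebra_simps)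
    then have "e \<le> int s2 + \<tau>" using B'0 by simp
    then show ?thesis using tr B(4,10) by linarith
  qed
  have tD: "\<tau> < int D" using tr B(10) by simp
  have ne: "a \<noteq> b" using less by auto
  define ex where "ex = (\<lambda>T. int n * (int A' * int (count T a) + int B' * int (count T b))
      - int A' * int B' * int \<sigma> * int (\<Sum>\<^sub># T))"
  have ex_add: "ex (T + T') = ex T + ex T'" for T T' unfolding ex_def by (simp add: algebra_simps)
  \<comment> \<open>For excess \<open>g\<close> the number \<open>x\<close> of ones satisfies
    \<open>B' * x = B' * r2 * i - b * g - \<tau> * y\<close>, and \<open>x \<ge> 0\<close> gives the
    first bound. For the second, \<open>g = 1\<close> forces \<open>y\<close> into the class of
    \<open>y0\<close> modulo \<open>B'\<close>, so \<open>y \<ge> y0\<close>; for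
    \<open>g \<ge> 2\<close> the extra \<open>b\<close> outweighs
    \<open>\<tau> * y0\<close>.\<close>
  have key: "\<exists>g. 0 < g \<and> ex T = int n * g \<and> int b * g + \<tau> * int (count T a) \<le> int B' * int r2 * int i
        \<and> l \<le> int r2 * int i"
    if T: "set_mset T \<subseteq> {1, a, b}" "\<Sum>\<^sub># T = n * i" "0 < ex T" for T i
  proof -
    define x y z where xyz: "x = count T 1" "y = count T a" "z = count T b"
    have "x + y * a + z * b = n * i"
      using sum_three[OF T(1)] A(14) B(14) ne T(2) unfolding xyz by simp
    then have eq: "int x + int y * int a + int z * int b = int n * int i"
      by (metis of_nat_add of_nat_mult)
    define g where "g = int A' * int y + int B' * int z - int A' * int B' * int \<sigma> * int i"
    have exg: "ex T = int n * g" unfolding ex_def g_def xyz T(2) by (simp add: algebra_simps)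
    then have g0: "0 < g" using T(3) n_pos by (simp add: zero_less_mult_iff)
    have nn: "int n = int A' * int \<sigma> * int b + int r2" using B(12) unfolding q2 by simp
    have "int B' * int x = int B' * int r2 * int i - int b * g - \<tau> * int y"
    proof -
      have "int B' * int x = int B' * (int n * int i) - int B' * int y * int a - int B' * int z * int b"
        unfolding eq[symmetric] by (simp add: algebra_simps)
      then show ?thesis unfolding nn g_def \<tau>_def by (simp add: algebra_simps)
    qed
    then have le: "int b * g + \<tau> * int y \<le> int B' * int r2 * int i"
      by (smt (verit) of_nat_0_le_iff mult_nonneg_nonneg)
    have "int b + \<tau> * int y0 \<le> int b * g + \<tau> * int y"
    proof (cases "g = 1")
      case True
      have "int A' * (int y - int y0) = int B' * (int A' * int \<sigma> * int i - int z - z0)"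
        using True z0 unfolding g_def by (simp add: algebra_simps)
      then have "int B' dvd int A' * (int y - int y0)" by simp
      then have d: "int B' dvd int y - int y0" using cop by (simp add: coprime_dvd_mult_right_iff)
      have "y0 \<le> y"
      proof (rule ccontr)
        assume "\<not> y0 \<le> y"
        then have "0 < int y0 - int y" "int B' dvd int y0 - int y" using d by (auto simp: dvd_diff_commute)
        then have "int B' \<le> int y0 - int y" using zdvd_imp_le by blast
        then show False using y0B by simp
      qed
      then show ?thesis using True t0 by simp
    next
      case False
      then have "int b * 2 \<le> int b * g" using g0 by (intro mult_left_mono) auto
      moreover have "\<tau> * int y0 \<le> int b"
      proof -
        have "\<tau> * int y0 \<le> int D * int B'" using tD t0 y0B by (intro mult_mono) auto
        also have "\<dots> \<le> int D * int B' * int w" 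
          using mult_left_mono[of 1 "int w" "int D * int B'"] w0 by simp
        also have "\<dots> \<le> int b" unfolding bw by (simp add: algebra_simps)
        finally show ?thesis .
      qed
      moreover have "0 \<le> \<tau> * int y" using t0 by simp
      ultimately show ?thesis by linarith
    qed
    then have "int B' * l \<le> int B' * (int r2 * int i)" using le l by (simp add: algebra_simps)
    then have "l \<le> int r2 * int i" using B'0 by simp
    then show ?thesis using g0 exg le unfolding xyz by blast
  qed
  \<comment> \<open>\<open>k\<close> counts how often copies of \<open>b\<close> are exchanged for
    copies of \<open>a\<close>. The second condition provides enough ones, the third enough copies
    of \<open>b\<close>.\<close>
  have make: "\<exists>M. set_mset M \<subseteq> {1, a, b} \<and> \<Sum>\<^sub># M = n * i \<and> ex M = int n
        \<and> int (count M a) = int y0 + k * int B'"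
    if k: "0 \<le> k" "l + k * \<tau> \<le> int r2 * int i" "k < int \<sigma> * int i" for k i
  proof -
    define x where "x = nat (int r2 * int i - l - k * \<tau>)"
    define y where "y = nat (int y0 + k * int B')"
    define z where "z = nat (int A' * int \<sigma> * int i - z0 - k * int A')"
    have "int A' * (k + 1) \<le> int A' * (int \<sigma> * int i)" using k A'0 by (intro mult_left_mono) auto
    then have iz: "int z = int A' * int \<sigma> * int i - z0 - k * int A'" unfolding z_def using z0A
      by (simp add: algebra_simps)
    have ix: "int x = int r2 * int i - l - k * \<tau>" unfolding x_def using k by simp
    have iy: "int y = int y0 + k * int B'" unfolding y_def using k by simp
    have nn: "int n = int A' * int \<sigma> * int b + int r2" using B(12) unfolding q2 by simp
    define M where "M = replicate_mset x 1 + replicate_mset y a + replicate_mset z b"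
    have "int x + int y * int a + int z * int b = int n * int i"
      unfolding ix iy iz l_def \<tau>_def nn by (simp add: algebra_simps)
    then have eq: "x + y * a + z * b = n * i" by (metis of_nat_add of_nat_mult of_nat_eq_iff)
    have sM: "\<Sum>\<^sub># M = n * i" unfolding M_def using eq by simp
    have cM: "count M a = y" "count M b = z" unfolding M_def using A(14) B(14) ne by auto
    have "int A' * int y + int B' * int z = int A' * int B' * int \<sigma> * int i + 1"
      using z0 unfolding iy iz by (simp add: algebra_simps)
    then have "ex M = int n" unfolding ex_def cM sM by (simp add: algebra_simps)
    moreover have "set_mset M \<subseteq> {1, a, b}" unfolding M_def by (auto split: if_splits)
    ultimately show ?thesis using sM cM iy by blast
  qed
  have sub: "{1, a, b} \<subseteq> S" using a b one_in by auto
  \<comment> \<open>\<open>l / r2\<close> rounded up: the least index compatible with positive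
    excess.\<close>
  define i1 where "i1 = nat ((l - 1) div int r2 + 1)"
  have l_gt: "int r2 < l"
  proof -
    have "int D * 1 \<le> int D * int w" using w0 by (intro mult_left_mono) auto
    then show ?thesis using e0 B(10) unfolding e_def by linarith
  qed
  have i1: "int i1 = (l - 1) div int r2 + 1" unfolding i1_def
    using l_gt B(5) pos_imp_zdiv_nonneg_iff[of "int r2" "l - 1"] by simp
  have i1_ge: "l \<le> int r2 * int i1"
  proof -
    have "l - 1 < int r2 * ((l - 1) div int r2) + int r2"
      using B(5) by (metis mult_div_mod_eq pos_mod_bound add_strict_left_mono of_nat_0_less_iff)
    then show ?thesis unfolding i1 by (simp add: algebra_simps)
  qed
  have i1_lt: "int r2 * (int i1 - 1) < l"
  proof -
    have "int r2 * ((l - 1) div int r2) \<le> l - 1"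
      using B(5) by (metis mult_div_mod_eq pos_mod_sign le_add_same_cancel1 of_nat_0_less_iff)
    then show ?thesis unfolding i1 by simp
  qed
  have i1_gt: "1 < i1"
  proof (rule ccontr)
    assume "\<not> 1 < i1"
    then have "int r2 * int i1 \<le> int r2 * 1" by (intro mult_left_mono) auto
    then show False using i1_ge l_gt by simp
  qed
  have min_i1: "int i1 \<le> int i" if "l \<le> int r2 * int i" for i
  proof -
    have "int r2 * (int i1 - 1) < int r2 * int i" using i1_lt that by simp
    then show ?thesis using B(5) by simp
  qed
  have atom_ex: "\<exists>U j. atom n S U \<and> U \<subseteq># M \<and> \<Sum>\<^sub># U = n * j \<and> j \<le> i \<and> 0 < ex U
      \<and> set_mset U \<subseteq> {1, a, b} \<and> int D dvd int j - 1"
    if M: "set_mset M \<subseteq> {1, a, b}" "\<Sum>\<^sub># M = n * i" "ex M = int n" for M i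
  proof -
    have "zero_sum n S M" using M sub unfolding zero_sum_def by auto
    then obtain U where U: "atom n S U" "U \<subseteq># M" "0 < ex U"
      using atom_positive[of n S M ex] ex_add M(3) n_pos by auto
    obtain j where j: "\<Sum>\<^sub># U = n * j" using atom_index[OF U(1) n_pos zero_notin] by blast
    have "n * j \<le> n * i" using sum_mset_mono_subset[OF U(2)] M(2) j by simp
    moreover have "int D dvd int j - 1" using good_D U j unfolding index_one_mod_def by blast
    moreover have "set_mset U \<subseteq> {1, a, b}" using U(2) M(1) by (meson mset_subset_eqD subset_iff)
    ultimately show ?thesis using U j n_pos by (intro exI[of _ U] exI[of _ j]) auto
  qed
  have "int D dvd int i1 - 1"
  proof -
    have "0 < int \<sigma> * int i1" using s0 i1_gt by simp
    then obtain M where M: "set_mset M \<subseteq> {1, a, b}" "\<Sum>\<^sub># M = n * i1" "ex M = int n"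
      using make[of 0 i1] i1_ge by auto
    obtain U j where U: "\<Sum>\<^sub># U = n * j" "j \<le> i1" "0 < ex U" "set_mset U \<subseteq> {1, a, b}" "int D dvd int j - 1"
      using atom_ex[OF M] by blast
    have "l \<le> int r2 * int j" using key[OF U(4,1,3)] by blast
    then have "j = i1" using min_i1 U(2) by (simp add: eq_iff)
    then show ?thesis using U by simp
  qed
  then obtain \<omega> where \<omega>: "int i1 = 1 + int D * \<omega>" by (metis add.commute diff_add_cancel dvdE)
  have \<omega>0: "0 < \<omega>" using \<omega> i1_gt D_ge2 by (smt (verit) mult_nonneg_nonpos of_nat_0_le_iff of_nat_1 of_nat_less_iff)
  \<comment> \<open>The number \<open>l = D * w + e\<close> lies above
    \<open>D * r2 * \<omega>\<close> and is at most \<open>D * r2 * \<omega> + r2\<close>. Since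
    \<open>e\<close> and \<open>r2\<close> are positive and below \<open>D\<close>, the multiples of
    \<open>D\<close> coincide.\<close>
  have w\<omega>: "int w = int r2 * \<omega>"
  proof -
    have 1: "int D * (int r2 * \<omega> - int w) < int D * 1"
      using i1_lt eD unfolding \<omega> e_def by (simp add: algebra_simps)
    have 2: "int D * (int w - int r2 * \<omega>) < int D * 1"
      using i1_ge e0 B(10) unfolding \<omega> e_def by (simp add: algebra_simps)
    have "int r2 * \<omega> - int w < 1" using 1 D_ge2 by (metis mult_less_cancel_left_pos of_nat_0_less_iff less_le_trans pos2)
    moreover have "int w - int r2 * \<omega> < 1" using 2 D_ge2 by (metis mult_less_cancel_left_pos of_nat_0_less_iff less_le_trans pos2)
    ultimately show ?thesis by simp
  qed
  have l_eq: "l = int D * int r2 * \<omega> + e" using w\<omega> unfolding e_def by (simp add: algebra_simps)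
  \<comment> \<open>The largest \<open>k\<close> with
    \<open>l + k * \<tau> \<le> r2 * (i1 + \<tau>)\<close>: as many copies of \<open>a\<close> as
    the ones can pay for at index \<open>i1 + \<tau>\<close>.\<close>
  define k where "k = (int r2 * (\<tau> + 1) - e) div \<tau>"
  have er: "e \<le> int r2" using i1_ge unfolding l_eq \<omega> by (simp add: algebra_simps)
  have k1: "k * \<tau> \<le> int r2 * (\<tau> + 1) - e" unfolding k_def using t0
    by (metis mult_div_mod_eq pos_mod_sign le_add_same_cancel1 mult.commute)
  have k2: "int r2 * (\<tau> + 1) - e < k * \<tau> + \<tau>" unfolding k_def using t0
    by (metis mult_div_mod_eq pos_mod_bound add_strict_left_mono mult.commute)
  have rt0: "0 \<le> int r2 * \<tau>" using t0 by simp
  have "int r2 * (\<tau> + 1) = int r2 * \<tau> + int r2" by (simp add: algebra_simps)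
  then have "0 \<le> int r2 * (\<tau> + 1) - e" using er rt0 by linarith
  then have k0: "0 \<le> k" unfolding k_def using t0 by (simp add: pos_imp_zdiv_nonneg_iff)
  define i where "i = nat (int D * \<omega> + \<tau> + 1)"
  have i: "int i = int D * \<omega> + \<tau> + 1" unfolding i_def using \<omega>0 t0 by simp
  have "k < int \<sigma> * int i"
  proof -
    have "int r2 * 1 \<le> int r2 * \<tau>" using t0 by (intro mult_left_mono) auto
    then have "k * \<tau> < (2 * int r2) * \<tau>" using k1 e0 by (simp add: algebra_simps)
    then have "k < 2 * int r2" using t0 by simp
    moreover have "int D * 1 \<le> int D * \<omega>" using \<omega>0 by (intro mult_left_mono) auto
    moreover have "1 * int i \<le> int \<sigma> * int i" using s0 by (intro mult_right_mono) auto
    ultimately show ?thesis using B(10) t0 i by linarith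
  qed
  moreover have "l + k * \<tau> \<le> int r2 * int i" using k1 unfolding l_eq i by (simp add: algebra_simps)
  ultimately obtain M where M: "set_mset M \<subseteq> {1, a, b}" "\<Sum>\<^sub># M = n * i" "ex M = int n"
     "int (count M a) = int y0 + k * int B'"
    using make[of k i] k0 by blast
  obtain U j where U: "atom n S U" "U \<subseteq># M" "\<Sum>\<^sub># U = n * j" "j \<le> i" "0 < ex U" "set_mset U \<subseteq> {1, a, b}"
     "int D dvd int j - 1"
    using atom_ex[OF M(1-3)] by blast
  obtain g where g: "0 < g" "int b * g + \<tau> * int (count U a) \<le> int B' * int r2 * int j" "l \<le> int r2 * int j"
    using key[OF U(6,3,5)] by blast
  \<comment> \<open>Both \<open>i1\<close> and \<open>j\<close> are 1 modulo \<open>D\<close>, and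
    they differ by at most \<open>\<tau> < D\<close>.\<close>
  have j_eq: "int j = 1 + int D * \<omega>"
  proof -
    have "int i1 \<le> int j" using min_i1 g(3) by blast
    moreover have "int D dvd (int j - 1) - (int i1 - 1)"
      by (rule dvd_diff[OF U(7)]) (simp add: \<omega>)
    then have "int D dvd int j - int i1" by simp
    moreover have "int j - int i1 < int D" using U(4) i tD unfolding \<omega> by simp
    ultimately have "int j - int i1 = 0" by (cases "int j - int i1 = 0") (auto dest: zdvd_imp_le)
    then show ?thesis using \<omega> by simp
  qed
  define N where "N = M - U"
  have MN: "M = U + N" using U(2) unfolding N_def by simp
  have sumN: "\<Sum>\<^sub># N = n * nat \<tau>"
  proof -
    have "int n * int j + int (\<Sum>\<^sub># N) = int n * int i" using M(2) U(3) unfolding MN by (metis of_nat_add of_nat_mult sum_mset.union)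
    then have "int (\<Sum>\<^sub># N) = int n * \<tau>" unfolding i j_eq by (simp add: algebra_simps)
    then show ?thesis using t0 by (metis int_nat_eq of_nat_eq_iff of_nat_mult order_less_imp_le)
  qed
  have zN: "zero_sum n S N" using M(1) sub sumN unfolding zero_sum_def MN by auto
  \<comment> \<open>\<open>N\<close> has index \<open>\<tau> \<le> D\<close>, so it splits into
    atoms of index one, each with at most \<open>n div a = q1\<close> copies of
    \<open>a\<close>.\<close>
  have "count N a \<le> q1 * nat \<tau>"
  proof (rule count_le_of_small_index[OF good_D n_pos zero_notin zN sumN])
    show "nat \<tau> \<le> D" using tD by simp
    fix V assume V: "V \<subseteq># N" "\<Sum>\<^sub># V = n"
    have "set_mset V \<subseteq> {1, a, b}" using V(1) M(1) unfolding MN by (metis mset_subset_eqD subset_iff UnCI set_mset_union)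
    then have "count V a * a \<le> n" using sum_three[of V 1 a b] A(14) B(14) ne V(2) by simp
    then show "count V a \<le> q1" unfolding qr using a zero_notin
      by (metis bot_nat_0.not_eq_extremum less_eq_div_iff_mult_less_eq)
  qed
  then have cN: "int (count N a) \<le> int B' * int \<sigma> * \<tau>" using t0 unfolding q1
    by (metis int_nat_eq of_nat_le_iff of_nat_mult order_less_imp_le)
  have cU: "int (count U a) = int y0 + k * int B' - int (count N a)" using M(4) unfolding MN by simp
  have "int b * 1 \<le> int b * g" using g(1) by (intro mult_left_mono) auto
  then have up: "\<tau> * int (count U a) \<le> int B' * int r2 * (1 + int D * \<omega>) - int b"
    using g(2) unfolding j_eq by simp
  \<comment> \<open>The copies of \<open>a\<close> that do not fit into \<open>N\<close> must lie in
    \<open>U\<close>, where \<open>key\<close> bounds them. With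
    \<open>\<sigma> * \<tau> = r2 - r1\<close> the two bounds collide for every
    \<open>r1 \<ge> 1\<close>.\<close>
  have "\<tau> * (int y0 + k * int B' - int B' * int \<sigma> * \<tau>) \<le> \<tau> * int (count U a)"
    using cN cU t0 by (intro mult_left_mono) auto
  then have "\<tau> * int y0 + int B' * (k * \<tau>) - int B' * \<tau> * (int \<sigma> * \<tau>) \<le> int B' * int r2 - int s2"
    using up unfolding bw w\<omega> by (simp add: algebra_simps)
  moreover have "int B' * (int r2 * (\<tau> + 1) - e - \<tau> + 1) \<le> int B' * (k * \<tau>)" 
    using k2 by (intro mult_left_mono) auto
  ultimately have "\<tau> * int y0 + int B' * (int r2 * (\<tau> + 1) - e - \<tau> + 1) - int B' * \<tau> * (int r2 - int r1)
      \<le> int B' * int r2 - int s2" unfolding st by linarith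
  then have "int B' * (\<tau> * (int r1 - 1) + 1) \<le> 0" using e by (simp add: algebra_simps)
  moreover have "0 \<le> \<tau> * (int r1 - 1)" using t0 A(5) by simp
  then have "0 < int B' * (\<tau> * (int r1 - 1) + 1)" using B'0 by (simp add: add_nonneg_pos)
  ultimately show False by simp
qed

lemma mod_nondivisors_eq:
  assumes "a \<in> S" "\<not> a dvd n" "b \<in> S" "\<not> b dvd n"
  shows "n mod a = n mod b"
  using mod_nondivisors_not_less[OF assms(1,2,3,4)] mod_nondivisors_not_less[OF assms(3,4,1,2)]
  by simp

end

section \<open>A second generator\<close>

lemma coprime_not_dvd:
  fixes a n :: nat
  shows "coprime a n \<Longrightarrow> a \<noteq> 1 \<Longrightarrow> \<not> a dvd n"
  by (metis coprime_absorb_left is_unit_gcd_iff nat_dvd_1_iff_1 gcd_nat.absorb1)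

text \<open>For \<open>c1 = r\<close> and \<open>c2 = q\<close> the numerator
  \<open>n - r - q\<close> equals \<open>q * (a - 1) = q * E * r\<close>.\<close>

lemma quot_values:
  fixes n q a r E d e :: nat
  assumes "n = q * a + r" "a = 1 + E * r" "E * r * d = n * e" "0 < q" "0 < r"
  shows "quot1 n r q = of_nat E" "quot2 n r q d = of_nat e"
proof -
  have "n = r + q + q * (E * r)" using assms by (simp add: algebra_simps)
  then have *: "of_nat n - of_nat r - of_nat q = (of_nat q * (of_nat E * of_nat r) :: rat)"
    by (metis add_diff_cancel_left' diff_diff_eq of_nat_add of_nat_mult)
  show "quot1 n r q = of_nat E" using assms(4,5) unfolding quot1_def * by simp
  have "0 < n" using assms by simp
  moreover have "of_nat E * of_nat r * of_nat d = (of_nat n * of_nat e :: rat)"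
    using assms(3) by (metis of_nat_mult)
  ultimately show "quot2 n r q d = of_nat e" using assms(4) unfolding quot2_def *
    by (simp add: field_simps)
qed

lemma I_setI:
  fixes n q a r E d e :: nat
  assumes "n = q * a + r" "a = 1 + E * r" "E * r * d = n * e" "0 < q" "0 < r" "0 < E" "0 < d" "d dvd n"
  shows "gcd E e \<in> I_set n"
proof -
  have "0 < n" using assms by simp
  have "0 < e" using assms by (metis mult_is_0 neq0_conv)
  have "r \<le> n" "q \<le> n" using assms by auto
  then have "(r, q, d) \<in> M_set n"
    unfolding M_set_def using quot_values[OF assms(1-5)] assms \<open>0 < e\<close> by auto
  then show ?thesis unfolding I_set_def using quot_values[OF assms(1-5)] by fastforce
qed

text \<open>The two quotients are \<open>E\<close> and \<open>e\<close>; setting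
  \<open>a = 1 + E * r\<close> recovers \<open>n = q * a + r\<close> from the first of them.\<close>

lemma I_setE:
  assumes "D \<in> I_set n"
  obtains q a r E d e where "n = q * a + r" "a = 1 + E * r" "E * r * d = n * e" "0 < q" "0 < r"
    "0 < E" "0 < d" "d dvd n" "0 < e" "D = gcd E e"
proof -
  obtain E e r q d where D: "D = gcd E e" and M: "(r, q, d) \<in> M_set n"
    and E: "of_nat E = quot1 n r q" and e: "of_nat e = quot2 n r q d"
    using assms unfolding I_set_def by blast
  have pos: "0 < q" "0 < r" "0 < d" "d dvd n" "q \<le> n" using M unfolding M_set_def by auto
  have "quot1 n r q \<noteq> 0" "quot2 n r q d \<noteq> 0" using M unfolding M_set_def by auto
  then have Ee: "0 < E" "0 < e" using E e by (auto intro!: Nat.gr0I)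
  have *: "(of_nat n - of_nat r - of_nat q :: rat) = of_nat E * (of_nat r * of_nat q)"
    using E pos unfolding quot1_def by (simp add: field_simps)
  then have "(of_nat n :: rat) = of_nat (E * (r * q) + r + q)" by (simp add: algebra_simps)
  then have n: "n = E * (r * q) + r + q" by (simp only: of_nat_eq_iff)
  have "(of_nat e :: rat) * (of_nat q * of_nat n) = of_nat E * (of_nat r * of_nat q) * of_nat d"
    using e pos unfolding quot2_def * by (simp add: field_simps)
  then have "(of_nat (e * (q * n)) :: rat) = of_nat (E * (r * q) * d)" by simp
  then have "e * (q * n) = E * (r * q) * d" by (simp only: of_nat_eq_iff)
  then have "q * (E * r * d) = q * (n * e)" by (simp only: ac_simps)
  then have "E * r * d = n * e" using pos by simp
  moreover have "n = q * (1 + E * r) + r" using n by (simp add: algebra_simps)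
  ultimately show ?thesis using that[of q "1 + E * r" r E d e] pos Ee D by blast
qed

text \<open>Here \<open>K\<close> is the inverse of \<open>a\<close> modulo \<open>n\<close>: the number \<open>\<kappa>\<close> is the index of the sequence
  with respect to the second generator \<open>a\<close>, except that \<open>\<delta>\<close> keeps its weight.\<close>

lemma second_index:
  fixes n q a r E \<delta> f e D x Y Z i :: nat
  assumes n: "n = q * a + r" and a: "a = 1 + E * r" and f: "n = \<delta> * f" "E * r = f * e"
    and D: "D dvd E" "D dvd e" and n0: "0 < n"
    and sum: "x + \<delta> * Z + a * Y = n * i"
  obtains \<kappa> where "n * \<kappa> = (1 + q * E) * x + Y + \<delta> * Z" "int D dvd int i - int \<kappa>"
proof -
  obtain E' where E': "E = D * E'" using D(1) by (elim dvdE)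
  obtain t where t: "e = D * t" using D(2) by (elim dvdE)
  define K where "K = 1 + int q * int E"
  \<comment> \<open>The cofactor in \<open>q * E = f * D * m\<close>, found by expanding
    \<open>q * E = (a * K - 1) - (a - 1) * K\<close>.\<close>
  define m where "m = int \<delta> * int E' - K * int t"
  define k where "k = int i + int q * int E * int i - int E * int Y - int D * m * int Z"
  have in1: "int n = int q * int a + int r" using n by (metis of_nat_add of_nat_mult)
  have in2: "int n = int \<delta> * int f" using f by (metis of_nat_mult)
  have ia: "int a = 1 + int E * int r" using a by simp
  have Er: "int E * int r = int f * int D * int t" using f(2) t by (metis of_nat_mult mult.assoc)
  have am1: "int a - 1 = int f * int D * int t" using ia Er by simp
  have aK: "int a * K = 1 + int n * int E"
    unfolding K_def in1 ia by (simp add: algebra_simps)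
  have K1: "int q * int E = int f * int D * m"
  proof -
    have "int q * int E = K - 1" unfolding K_def by simp
    also have "\<dots> = (int a * K - 1) - (int a - 1) * K" by (simp add: algebra_simps)
    also have "\<dots> = int n * int E - int f * int D * int t * K" unfolding aK am1 by simp
    also have "\<dots> = int f * int D * m" unfolding m_def in2 E' by (simp add: algebra_simps)
    finally show ?thesis .
  qed
  have isum: "int x + int \<delta> * int Z + int a * int Y = int n * int i"
    using sum by (metis of_nat_add of_nat_mult)
  \<comment> \<open>Modulo \<open>n\<close>, multiplication by \<open>K\<close> turns
    \<open>a\<close> into 1, and it fixes multiples of \<open>\<delta>\<close> because
    \<open>K\<close> is 1 modulo \<open>f\<close>.\<close>
  have "K * int x + int Y + int \<delta> * int Z
      = K * (int x + int \<delta> * int Z + int a * int Y) - (int a * K - 1) * int Y - (K - 1) * int \<delta> * int Z"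
    by (simp add: algebra_simps)
  also have "\<dots> = K * int n * int i - int n * int E * int Y - int f * int D * m * int \<delta> * int Z"
    unfolding isum aK by (simp add: K_def K1)
  also have "\<dots> = int n * (K * int i - int E * int Y - int D * m * int Z)"
    unfolding in2 by (simp add: algebra_simps)
  also have "\<dots> = int n * k"
    unfolding k_def K_def by (simp add: algebra_simps)
  finally have nk: "int n * k = K * int x + int Y + int \<delta> * int Z" by simp
  have "0 \<le> K" unfolding K_def by simp
  then have "0 \<le> int n * k" unfolding nk by simp
  then have k0: "0 \<le> k" using n0 by (simp add: zero_le_mult_iff)
  have "int (n * nat k) = int ((1 + q * E) * x + Y + \<delta> * Z)"
    using nk k0 unfolding K_def by (simp add: algebra_simps)
  then have "n * nat k = (1 + q * E) * x + Y + \<delta> * Z" by (simp only: of_nat_eq_iff)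
  moreover have "int i - int (nat k) = int D * (int E' * int Y + m * int Z - int q * int E' * int i)"
    using k0 unfolding k_def E' by (simp add: algebra_simps)
  then have "int D dvd int i - int (nat k)" by simp
  ultimately show ?thesis using that by blast
qed

text \<open>An atom of index other than one has no subsequence of sum \<open>n\<close>. Greedy
  subset sums turn this into bounds that keep each of the three parts of \<open>n * \<kappa>\<close>
  below \<open>n\<close>, so \<open>\<kappa> < 3\<close>. The chain \<open>C\<close> is the set of
  all divisors of \<open>n\<close> in \<open>coprime_case\<close> and \<open>{1, d}\<close> in
  \<open>I_set_realized\<close>.\<close>

lemma atom_second_index:
  fixes n q a r E \<delta> f e D i :: nat
  assumes n: "n = q * a + r" and a: "a = 1 + E * r" and f: "n = \<delta> * f" "E * r = f * e"
    and D: "D dvd E" "D dvd e" and pos: "0 < q" "0 < r" "0 \<notin> S"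
    and chain: "\<And>x y. x \<in> C \<Longrightarrow> y \<in> C \<Longrightarrow> x dvd y \<or> y dvd x"
    and S_div: "\<And>g. g \<in> S \<Longrightarrow> g dvd n \<Longrightarrow> g \<in> C \<and> (\<delta> dvd g \<or> g dvd q \<and> g dvd r)"
    and S_nondiv: "\<And>g. g \<in> S \<Longrightarrow> \<not> g dvd n \<Longrightarrow> \<exists>s\<in>C. g = s * a \<and> s dvd q \<and> s dvd r"
    and U: "atom n S U" "\<Sum>\<^sub># U = n * i"
    and not: "\<not> int D dvd int i - 1"
  defines "N \<equiv> filter_mset (\<lambda>g. \<not> g dvd n) U"
    and "L \<equiv> filter_mset (\<lambda>g. g dvd n \<and> \<delta> dvd g) U"
    and "P \<equiv> filter_mset (\<lambda>g. g dvd n \<and> \<not> \<delta> dvd g) U"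
  obtains Y \<kappa> where "\<Sum>\<^sub># N = a * Y" "(1 + q * E) * \<Sum>\<^sub># P < n" "\<Sum>\<^sub># L < n" "Y < n"
    "n * \<kappa> = (1 + q * E) * \<Sum>\<^sub># P + Y + \<Sum>\<^sub># L" "int D dvd int i - int \<kappa>" "\<kappa> \<in> {1, 2}"
proof -
  have n0: "0 < n" using n pos a by simp
  have a0: "0 < a" using a by simp
  have US: "set_mset U \<subseteq> S" using U(1) unfolding atom_def zero_sum_def by blast
  have U_eq: "U = P + L + N" unfolding P_def L_def N_def by (rule multiset_eqI) auto
  have i1: "1 \<le> i" using atom_index[OF U(1) n0 pos(3)] U(2) n0
    by (metis One_nat_def Suc_leI mult_cancel1 not_gr0)
  have i_ne: "i \<noteq> 1" using not by auto
  have whole: "\<Sum>\<^sub># T = n * i" if "T \<subseteq># U" "n dvd \<Sum>\<^sub># T" "0 < \<Sum>\<^sub># T" for T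
  proof -
    have "T \<noteq> {#}" using that(3) by auto
    then show ?thesis using atom_subset_eq[OF U(1) that(1) _ that(2)] U(2) by simp
  qed
  have not_n: "\<Sum>\<^sub># T \<noteq> n" if "T \<subseteq># U" for T
  proof
    assume T: "\<Sum>\<^sub># T = n"
    then have "n = n * i" using whole[OF that] n0 by (metis dvd_refl)
    then show False using n0 i_ne by simp
  qed
  have PL: "g \<in> C" "g dvd n" if "g \<in># P + L" for g
    using that US S_div unfolding P_def L_def by auto
  have PLn: "\<Sum>\<^sub># (P + L) < n"
  proof (rule ccontr)
    assume "\<not> \<Sum>\<^sub># (P + L) < n"
    then have le: "n \<le> \<Sum>\<^sub># (P + L)" by simp
    obtain T where T: "T \<subseteq># P + L" "\<Sum>\<^sub># T = n"
      using chain_subset_sum[OF chain[OF PL(1) PL(1)] PL(2) le] .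
    then have "T \<subseteq># U" unfolding U_eq by (metis mset_subset_eq_add_left subset_mset.order_trans)
    then show False using not_n T(2) by blast
  qed
  have NS: "\<exists>s\<in>C. g = s * a \<and> s dvd q \<and> s dvd r" if "g \<in># N" for g
    using that US S_nondiv unfolding N_def by auto
  have "a dvd \<Sum>\<^sub># N"
  proof (rule sum_mset_dvd)
    fix g assume "g \<in># N"
    then obtain s where "g = s * a" using NS by blast
    then show "a dvd g" by simp
  qed
  then obtain Y where Y: "\<Sum>\<^sub># N = a * Y" by (elim dvdE)
  have Nsub: "\<exists>T. T \<subseteq># N \<and> \<Sum>\<^sub># T = a * t" if "t \<le> Y" "\<And>s. s dvd q \<Longrightarrow> s dvd r \<Longrightarrow> s dvd t" for t
  proof -
    have "x dvd y \<or> y dvd x" if "x \<in># N" "y \<in># N" for x y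
      using NS[OF that(1)] NS[OF that(2)] chain by (metis mult_dvd_mono dvd_refl)
    moreover have "x dvd a * t" if "x \<in># N" for x
      using NS[OF that] \<open>\<And>s. s dvd q \<Longrightarrow> s dvd r \<Longrightarrow> s dvd t\<close> by (metis mult.commute mult_dvd_mono dvd_refl)
    moreover have "a * t \<le> \<Sum>\<^sub># N" using Y \<open>t \<le> Y\<close> by simp
    ultimately obtain T where "T \<subseteq># N" "\<Sum>\<^sub># T = a * t" by (rule chain_subset_sum)
    then show ?thesis by blast
  qed
  have NU: "T \<subseteq># U" if "T \<subseteq># N" for T using that unfolding U_eq
    by (metis mset_subset_eq_add_right subset_mset.order_trans)
  \<comment> \<open>Otherwise a subsequence of sum \<open>a * n\<close> is all of \<open>U\<close>,
    whose index \<open>a\<close> is then 1 modulo \<open>D\<close>.\<close>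
  have Yn: "Y < n"
  proof (rule ccontr)
    assume "\<not> Y < n"
    moreover have "s dvd n" if "s dvd q" "s dvd r" for s using that n by simp
    ultimately obtain T where T: "T \<subseteq># N" "\<Sum>\<^sub># T = a * n" using Nsub[of n] by auto
    then have "a * n = n * i" using whole[OF NU[OF T(1)]] a0 n0 by simp
    then have "i = a" using n0 by simp
    then show False using not a D(1) by simp
  qed
  have Yq: "q \<le> Y"
  proof (rule ccontr)
    assume "\<not> q \<le> Y"
    then have "a * Y \<le> a * q" by simp
    moreover have "a * q \<le> n" using n by simp
    ultimately have "\<Sum>\<^sub># N \<le> n" using Y by linarith
    moreover have "\<Sum>\<^sub># U = \<Sum>\<^sub># (P + L) + \<Sum>\<^sub># N" unfolding U_eq by simp
    ultimately have "n * i < n * 2" using PLn U(2) by linarith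
    then show False using i1 i_ne by simp
  qed
  \<comment> \<open>Otherwise a part of \<open>P\<close> of sum \<open>r\<close> and a part of
    \<open>N\<close> of sum \<open>a * q\<close> would together have sum \<open>n\<close>.\<close>
  have Pr: "\<Sum>\<^sub># P < r"
  proof (rule ccontr)
    assume "\<not> \<Sum>\<^sub># P < r"
    then have "r \<le> \<Sum>\<^sub># P" by simp
    have "x dvd y \<or> y dvd x" if "x \<in># P" "y \<in># P" for x y using PL chain that by auto
    moreover have "x dvd r" if "x \<in># P" for x using that S_div US unfolding P_def by auto
    ultimately obtain T where T: "T \<subseteq># P" "\<Sum>\<^sub># T = r"
      using \<open>r \<le> \<Sum>\<^sub># P\<close> by (rule chain_subset_sum)
    obtain T' where T': "T' \<subseteq># N" "\<Sum>\<^sub># T' = a * q" using Nsub[OF Yq] by auto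
    have "T + T' \<subseteq># P + N" using T T' by (intro subset_mset.add_mono)
    also have "P + N \<subseteq># U" unfolding U_eq by (simp add: subset_mset.add_increasing2)
    finally show False using not_n[of "T + T'"] T T' n by (simp add: algebra_simps)
  qed
  have nK: "n = q + r * (1 + q * E)" unfolding n a by (simp add: algebra_simps)
  have KP: "(1 + q * E) * \<Sum>\<^sub># P < n"
  proof -
    have "(1 + q * E) * \<Sum>\<^sub># P \<le> (1 + q * E) * r" using Pr by (intro mult_left_mono) auto
    then show ?thesis using nK pos by (simp add: mult.commute)
  qed
  have "\<delta> dvd \<Sum>\<^sub># L" unfolding L_def by (intro sum_mset_dvd) auto
  then obtain Z where Z: "\<Sum>\<^sub># L = \<delta> * Z" by (elim dvdE)
  have "\<Sum>\<^sub># P + \<delta> * Z + a * Y = n * i" using U(2) Y Z unfolding U_eq by simp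
  then obtain \<kappa> where \<kappa>: "n * \<kappa> = (1 + q * E) * \<Sum>\<^sub># P + Y + \<delta> * Z" "int D dvd int i - int \<kappa>"
    using second_index[OF n a f D n0] by blast
  have "n * \<kappa> < n * 3" using \<kappa>(1) KP Yn PLn Z by simp
  moreover have "\<kappa> \<noteq> 0"
    using \<kappa>(1) Yq pos by (metis add_is_0 le_zero_eq mult_0_right neq0_conv)
  ultimately have "\<kappa> \<in> {1, 2}" by auto
  then show ?thesis using that[of Y \<kappa>] Y KP PLn Yn \<kappa> Z by simp
qed

text \<open>In a zero-sum subsequence the number of copies of \<open>a\<close> is divisible by
  \<open>d\<close>, hence 0 or \<open>d\<close>. In the first case the sum is below
  \<open>n\<close>; in the second the number of copies of \<open>d\<close> is fixed modulo
  \<open>f\<close> and thus equals \<open>z\<close>.\<close>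

lemma coprime_divisor_atom:
  fixes n a d f z :: nat
  assumes S: "a \<in> S" "d \<in> S" "0 \<notin> S" and a: "coprime a n" and ne: "a \<noteq> d"
    and f: "n = d * f" "0 < n" and zf: "z < f" and z: "f dvd a + z"
  shows "atom n S (replicate_mset d a + replicate_mset z d)"
proof -
  define M where "M = replicate_mset d a + replicate_mset z d"
  have d0: "0 < d" and dn: "d dvd n" using f by auto
  have sM: "\<Sum>\<^sub># M = d * (a + z)" unfolding M_def by (simp add: algebra_simps)
  have setM: "set_mset M \<subseteq> {a, d}" unfolding M_def by (auto split: if_splits)
  have zeroM: "0 \<notin># M" using setM S by auto
  have cM: "count M a = d" "count M d = z" unfolding M_def using ne by auto
  have "atom n S M"
  proof (rule atomI)
    show "zero_sum n S M" unfolding zero_sum_def using setM sM S z unfolding f(1) by auto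
    show "M \<noteq> {#}" unfolding M_def using d0 by (cases d) auto
    fix T assume T: "T \<subseteq># M" "T \<noteq> {#}" "n dvd \<Sum>\<^sub># T"
    have sT: "set_mset T \<subseteq> {a, d}" using T setM by (meson mset_subset_eqD subset_iff)
    define y w where yw: "y = count T a" "w = count T d"
    have sumT: "\<Sum>\<^sub># T = y * a + w * d" using sum_two[OF sT ne] unfolding yw .
    have le: "y \<le> d" "w \<le> z" using T(1) cM unfolding yw by (metis mset_subset_eq_count)+
    have "d dvd y * a + w * d" using T(3) dn unfolding sumT by (rule dvd_trans[rotated])
    then have "d dvd y * a" by (simp add: dvd_add_left_iff)
    moreover have "coprime d a" using a dn by (metis coprime_commute coprime_divisors dvd_refl)
    ultimately have "d dvd y" by (simp add: coprime_dvd_mult_left_iff)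
    then have "y = 0 \<or> y = d" using le(1) dvd_imp_le by fastforce
    then have "y = d"
    proof
      assume y: "y = 0"
      have "w * d < n" using le zf d0 unfolding f(1) by (simp add: mult.commute)
      then have "w * d = 0" using T(3) y unfolding sumT by (auto dest: dvd_imp_le)
      then have "w = 0" using d0 by simp
      then have "\<Sum>\<^sub># T = 0" using y sumT by simp
      moreover have "0 \<notin># T" using T(1) zeroM by (meson mset_subset_eqD)
      ultimately show ?thesis using sum_mset_pos[OF T(2)] by (metis less_irrefl)
    qed
    then have "d * f dvd d * (a + w)" using T(3) unfolding sumT f(1) by (simp add: algebra_simps)
    then have "f dvd a + w" using d0 by simp
    then have "f dvd (a + z) - (a + w)" using z by (intro dvd_diff_nat)
    then have "f dvd z - w" by simp
    then have "z = w" using zf le by (metis diff_is_0_eq dvd_imp_le eq_iff less_imp_diff_less not_less zero_less_diff)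
    then have "\<Sum>\<^sub># T = \<Sum>\<^sub># M" using \<open>y = d\<close> sumT unfolding M_def by simp
    then show "T = M" using subset_eq_sum_eq[OF T(1) zeroM] by simp
  qed
  then show ?thesis unfolding M_def .
qed

context large_gap
begin

text \<open>The sequence of \<open>q * d\<close> copies of \<open>a\<close> and \<open>r\<close>
  copies of \<open>d\<close> has index \<open>d \<le> D\<close>, so it splits into atoms of index
  one. One of them contains at least \<open>q\<close> copies of \<open>a\<close>, in fact exactly
  \<open>q\<close>, and its copies of \<open>d\<close> add up to \<open>r\<close>.\<close>

lemma divisor_small:
  assumes a: "a \<in> S" "\<not> a dvd n" and d: "d \<in> S" "d dvd n" "d \<le> D"
  shows "d dvd n mod a"
proof -
  define q r where qr: "q = n div a" "r = n mod a"
  have a0: "0 < a" "a \<le> n" using a S_sub by auto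
  have q0: "0 < q" unfolding qr using a0 by (simp add: div_greater_zero_iff)
  have d0: "0 < d" using d S_sub by auto
  have ne: "a \<noteq> d" using a d by auto
  have nq: "n = q * a + r" unfolding qr by simp
  have ra: "r < a" unfolding qr using a0 by simp
  define M where "M = replicate_mset (q * d) a + replicate_mset r d"
  have sM: "\<Sum>\<^sub># M = n * d" unfolding M_def nq by (simp add: algebra_simps)
  have setM: "set_mset M \<subseteq> {a, d}" unfolding M_def by (auto split: if_splits)
  have zM: "zero_sum n S M" unfolding zero_sum_def using sM setM a d by auto
  have cM: "count M a = q * d" unfolding M_def using ne by simp
  have "\<exists>V. V \<subseteq># M \<and> \<Sum>\<^sub># V = n \<and> q \<le> count V a"
  proof (rule ccontr)
    assume *: "\<nexists>V. V \<subseteq># M \<and> \<Sum>\<^sub># V = n \<and> q \<le> count V a"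
    have "count M a \<le> (q - 1) * d"
    proof (rule count_le_of_small_index[OF good_D n_pos zero_notin zM sM d(3)])
      fix V assume "V \<subseteq># M" "\<Sum>\<^sub># V = n"
      then show "count V a \<le> q - 1" using * by force
    qed
    then show False using cM q0 d0 by (metis diff_less mult_less_cancel2 not_less zero_less_one)
  qed
  then obtain V where V: "V \<subseteq># M" "\<Sum>\<^sub># V = n" "q \<le> count V a" by blast
  have "set_mset V \<subseteq> {a, d}" using V(1) setM by (meson mset_subset_eqD subset_iff)
  then have sV: "count V a * a + count V d * d = q * a + r" using sum_two[of V a d] ne V(2) nq by simp
  have "count V a < q + 1"
  proof (rule ccontr)
    assume "\<not> count V a < q + 1"
    then have "(q + 1) * a \<le> count V a * a" by (intro mult_right_mono) auto
    then show False using sV ra by simp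
  qed
  then have "count V a = q" using V(3) by simp
  then have "count V d * d = r" using sV by simp
  then show ?thesis unfolding qr by (metis dvd_triv_right)
qed

text \<open>Here \<open>f = n / d < D\<close>. The atom of \<open>d\<close> copies of
  \<open>a\<close> and \<open>z\<close> copies of \<open>d\<close> has index 1 modulo
  \<open>D\<close>, which makes \<open>f - 1 - z\<close> a multiple of \<open>D\<close> in the range
  from 0 to \<open>D - 1\<close>. So \<open>z = f - 1\<close>, and
  \<open>E * r = f * (i - 1)\<close>.\<close>

lemma divisor_large:
  assumes a: "a \<in> S" "coprime a n" "a = 1 + E * r" "D dvd E" "a \<noteq> 1" and d: "d \<in> S" "d dvd n" "D < d"
  obtains m where "E * r * d = n * (D * m)"
proof -
  obtain f where f: "n = d * f" using d by (elim dvdE)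
  have f0: "0 < f" using f n_pos by auto
  have ne: "a \<noteq> d" using coprime_not_dvd[OF a(2,5)] d(2) by auto
  have fD: "f < D"
  proof (rule ccontr)
    assume "\<not> f < D"
    then have "D * D \<le> d * f" using d by (intro mult_le_mono) auto
    then show False using D_large n_pos f by linarith
  qed
  \<comment> \<open>The residue of \<open>-a\<close> modulo \<open>f\<close>.\<close>
  define z where "z = (a * (f - 1)) mod f"
  have zf: "z < f" unfolding z_def using f0 by simp
  have "a + a * (f - 1) = a * f" using f0 by (cases f) auto
  then have "f dvd a + z" unfolding z_def by (metis dvd_triv_right mod_add_right_eq dvd_eq_mod_eq_0)
  then obtain i where i: "a + z = f * i" by (elim dvdE)
  define M where "M = replicate_mset d a + replicate_mset z d"
  have sM: "\<Sum>\<^sub># M = n * i"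
  proof -
    have "\<Sum>\<^sub># M = d * (a + z)" unfolding M_def by (simp add: algebra_simps)
    then show ?thesis unfolding i f by simp
  qed
  have "atom n S M"
    unfolding M_def by (rule coprime_divisor_atom[OF a(1) d(1) zero_notin a(2) ne f n_pos zf]) (simp add: i)
  then have Di: "int D dvd int i - 1" using good_D sM unfolding index_one_mod_def by blast
  have eq: "int f * (int i - 1) = int E * int r - (int f - 1 - int z)"
  proof -
    have "int a + int z = int f * int i" using i by (metis of_nat_add of_nat_mult)
    then show ?thesis using a(3) by (simp add: algebra_simps)
  qed
  have "int D dvd int E * int r - int f * (int i - 1)" using a(4) Di by (intro dvd_diff) auto
  moreover have "int E * int r - int f * (int i - 1) = int f - 1 - int z" using eq by simp
  ultimately have "int D dvd int f - 1 - int z" by (simp only:)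
  moreover have "int f - 1 - int z < int D" "0 \<le> int f - 1 - int z" using fD zf by auto
  ultimately have "int f - 1 - int z = 0" by (cases "int f - 1 - int z = 0") (auto dest: zdvd_imp_le)
  then have eq2: "int E * int r = int f * (int i - 1)" using eq by simp
  have "1 \<le> i" using i a(3) by (cases i) auto
  then obtain m where m: "i - 1 = D * m" using Di by (metis dvdE of_nat_1 of_nat_diff of_nat_dvd_iff)
  have "int (E * r) = int (f * (i - 1))" using eq2 \<open>1 \<le> i\<close> by (simp add: of_nat_diff)
  then have "E * r = f * (D * m)" unfolding m by (simp only: of_nat_eq_iff)
  then have "E * r * d = n * (D * m)" unfolding f by simp
  then show ?thesis by (rule that)
qed

text \<open>The candidate is \<open>gcd E (D * m)\<close>, built from the least large divisor
  \<open>\<delta>\<close> in \<open>S\<close>. Applied with \<open>D\<close> the gcd of all indices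
  minus one, mutual divisibility gives \<open>D = D0\<close>.\<close>

theorem coprime_case:
  assumes a: "a \<in> S" "a \<noteq> 1" "coprime a n"
    and chain: "\<And>x y. x dvd n \<Longrightarrow> y dvd n \<Longrightarrow> x dvd y \<or> y dvd x"
  obtains D0 where "D0 \<in> I_set n" "D dvd D0" "index_one_mod n S D0"
proof -
  have an: "\<not> a dvd n" by (rule coprime_not_dvd[OF a(3,2)])
  define q r where qr: "q = n div a" "r = n mod a"
  have nq: "n = q * a + r" unfolding qr by simp
  obtain s E where sE: "a = s + E * r" "D dvd E" "0 < E" "0 < s" "s dvd r"
    using nondivisor_form[OF a(1) an] unfolding qr by blast
  have "s dvd a" using sE by simp
  moreover have "s dvd n" using \<open>s dvd a\<close> sE(5) unfolding nq by simp
  ultimately have "s = 1" using a(3) by (metis coprime_common_divisor_nat nat_dvd_1_iff_1)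
  then have aE: "a = 1 + E * r" using sE by simp
  obtain s1 A where A: "a = s1 + D * A" "s1 dvd r" "0 < r" "0 < q" "s1 * q + r < D" "n = (s1 * q + r) + D * (A * q)"
    using nondivisor_bounds[OF a(1) an] unfolding qr by metis
  have s1: "s1 = 1"
  proof -
    obtain E' where "E = D * E'" using sE(2) by (elim dvdE)
    then have "s1 + D * A = 1 + D * E' * r" using A(1) aE by metis
    then have "int (s1 + D * A) = int (1 + D * E' * r)" by (simp only:)
    then have "int s1 - 1 = int D * (int E' * int r - int A)" by (simp add: algebra_simps)
    then have "int D dvd int s1 - 1" by simp
    moreover have "s1 \<le> r" using A(2,3) by (rule dvd_imp_le)
    then have "int s1 - 1 < int D" using A(5) by simp
    moreover have "1 \<le> s1" using A(2,3) by (cases s1) auto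
    ultimately show ?thesis by (cases "int s1 - 1 = 0") (auto dest: zdvd_imp_le)
  qed
  \<comment> \<open>All non-divisors share the remainder \<open>r\<close>, so comparing the two
    expressions for \<open>n mod D\<close> gives \<open>q = t * qb\<close>, and
    \<open>qb * b = n - r = q * a\<close> then gives \<open>b = t * a\<close>.\<close>
  have nondiv: "\<exists>s. b = s * a \<and> s dvd q \<and> s dvd r" if b: "b \<in> S" "\<not> b dvd n" for b
  proof -
    have rb: "n mod b = r" unfolding qr using mod_nondivisors_eq[OF b a(1) an] .
    define qb where "qb = n div b"
    obtain t B where B: "b = t + D * B" "t dvd r" "0 < qb" "t * qb + r < D" "n = (t * qb + r) + D * (B * qb)"
      "n = qb * b + r"
      using nondivisor_bounds[OF b] unfolding rb qb_def by metis
    have "(s1 * q + r + D * (A * q)) mod D = s1 * q + r" using A(5) by simp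
    then have 1: "n mod D = s1 * q + r" unfolding A(6)[symmetric] .
    have "(t * qb + r + D * (B * qb)) mod D = t * qb + r" using B(4) by simp
    then have 2: "n mod D = t * qb + r" unfolding B(5)[symmetric] .
    have q: "q = t * qb" using 1 2 s1 by simp
    have "qb * b = q * a" using nq B(6) by simp
    then have "qb * b = t * qb * a" using q by simp
    then have "qb * b = qb * (t * a)" by (simp only: ac_simps)
    then have "b = t * a" using B(3) by simp
    then show ?thesis using q B(2) by auto
  qed
  have div_small: "d dvd q \<and> d dvd r" if d: "d \<in> S" "d dvd n" "d \<le> D" for d
  proof -
    have dr: "d dvd r" using divisor_small[OF a(1) an d] unfolding qr .
    have "d dvd q * a" using d(2) dr nq by (metis dvd_add_left_iff)
    moreover have "coprime d a" using a(3) d(2) by (metis coprime_commute coprime_divisors dvd_refl)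
    ultimately show ?thesis using dr by (simp add: coprime_dvd_mult_left_iff)
  qed
  \<comment> \<open>Inserting \<open>n\<close> provides a default for \<open>\<delta>\<close> if
    \<open>S\<close> has no large divisor; the required divisibility then follows from
    \<open>D dvd E\<close>.\<close>
  define X where "X = insert n {d \<in> S. d dvd n \<and> D < d}"
  have "finite S" using S_sub finite_subset by blast
  then have finX: "finite X" "X \<noteq> {}" unfolding X_def by auto
  define \<delta> where "\<delta> = Min X"
  have \<delta>X: "\<delta> \<in> X" unfolding \<delta>_def using finX by (rule Min_in)
  have \<delta>n: "\<delta> dvd n" using \<delta>X unfolding X_def by auto
  have \<delta>_dvd: "\<delta> dvd d" if "d \<in> X" for d
  proof -
    have le: "\<delta> \<le> d" unfolding \<delta>_def using finX that by simp
    have dn: "d dvd n" using that unfolding X_def by auto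
    have "0 < d" "0 < \<delta>" using dn \<delta>n n_pos by (auto intro: Nat.gr0I)
    then show ?thesis using chain[OF \<delta>n dn] le by (metis dvd_imp_le eq_iff dvd_refl)
  qed
  have "\<exists>m. E * r * \<delta> = n * (D * m)"
  proof (cases "\<delta> = n")
    case True
    obtain E' where "E = D * E'" using sE(2) by (elim dvdE)
    then have "E * r * \<delta> = n * (D * (E' * r))" using True by simp
    then show ?thesis ..
  next
    case False
    then have "\<delta> \<in> S" "D < \<delta>" using \<delta>X unfolding X_def by auto
    then show ?thesis using divisor_large[OF a(1,3) aE sE(2) a(2) _ \<delta>n] by metis
  qed
  then obtain m where m: "E * r * \<delta> = n * (D * m)" ..
  define D0 where "D0 = gcd E (D * m)"
  obtain f where f: "n = \<delta> * f" using \<delta>n by (elim dvdE)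
  have \<delta>0: "0 < \<delta>" using f n_pos by simp
  have fe: "E * r = f * (D * m)" using m \<delta>0 unfolding f by simp
  have "D0 \<in> I_set n" unfolding D0_def using I_setI[OF nq aE m A(4,3) sE(3) \<delta>0 \<delta>n] .
  moreover have DD0: "D dvd D0" unfolding D0_def using sE(2) by simp
  moreover have "index_one_mod n S D0"
    unfolding index_one_mod_def
  proof (intro allI impI, rule ccontr)
    fix U i assume U: "atom n S U" "\<Sum>\<^sub># U = n * i" "\<not> int D0 dvd int i - 1"
    have S1: "g \<in> {c. c dvd n} \<and> (\<delta> dvd g \<or> g dvd q \<and> g dvd r)" if "g \<in> S" "g dvd n" for g
    proof (cases "g \<le> D")
      case True
      then show ?thesis using div_small that by blast
    next
      case False
      then have "g \<in> X" using that unfolding X_def by auto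
      then show ?thesis using \<delta>_dvd that by blast
    qed
    have S2: "\<exists>s\<in>{c. c dvd n}. g = s * a \<and> s dvd q \<and> s dvd r" if "g \<in> S" "\<not> g dvd n" for g
    proof -
      obtain s where "g = s * a \<and> s dvd q \<and> s dvd r" using nondiv[OF \<open>g \<in> S\<close> \<open>\<not> g dvd n\<close>] by blast
      moreover from this have "s dvd n" unfolding nq by simp
      ultimately show ?thesis by blast
    qed
    have dv: "D0 dvd E" "D0 dvd D * m" unfolding D0_def by auto
    have ch: "x dvd y \<or> y dvd x" if "x \<in> {c. c dvd n}" "y \<in> {c. c dvd n}" for x y using chain that by blast
    have "\<exists>\<kappa>. int D0 dvd int i - int \<kappa> \<and> \<kappa> \<in> {1, 2}"
    proof (rule atom_second_index[OF nq aE f fe dv A(4,3) zero_notin, of "{c. c dvd n}" U i])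
      show "atom n S U" "\<Sum>\<^sub># U = n * i" "\<not> int D0 dvd int i - 1" by (fact U)+
    qed (use ch S1 S2 in blast)+
    then obtain \<kappa> where \<kappa>: "int D0 dvd int i - int \<kappa>" "\<kappa> \<in> {1, 2}" by blast
    \<comment> \<open>Modulo \<open>D\<close> the index is both 1 and \<open>\<kappa>\<close>; as
      \<open>D \<ge> 2\<close>, this excludes \<open>\<kappa> = 2\<close>.\<close>
    have "int D dvd int i - 1" using good_D U unfolding index_one_mod_def by blast
    moreover have "int D dvd int i - int \<kappa>" using \<kappa>(1) DD0 by (meson dvd_trans of_nat_dvd_iff)
    ultimately have "int D dvd (int i - 1) - (int i - int \<kappa>)" by (rule dvd_diff)
    then have "int D dvd int \<kappa> - 1" by simp
    then have "\<kappa> = 1" using \<kappa>(2) D_ge2 by auto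
    then show False using \<kappa>(1) U(3) by simp
  qed
  ultimately show ?thesis by (rule that)
qed

end

section \<open>Reduction modulo smaller prime powers\<close>

lemma I_set_realized:
  assumes "D \<in> I_set n"
  obtains S where "S \<subseteq> {1..n}" "1 \<in> S" "min_dist n S = D" "0 < D"
proof -
  obtain q a r E d e where n: "n = q * a + r" and a: "a = 1 + E * r" and Erd: "E * r * d = n * e"
    and pos: "0 < q" "0 < r" "0 < E" "0 < d" "0 < e" and dn: "d dvd n" and D: "D = gcd E e"
    using I_setE[OF assms] by metis
  have n0: "0 < n" using n pos by simp
  obtain f where f: "n = d * f" using dn by (elim dvdE)
  have fe: "E * r = f * e" using Erd pos unfolding f by simp
  have f0: "0 < f" using f n0 by (cases f) auto
  have an: "a \<le> n"
  proof -
    have "1 * a \<le> q * a" using pos by (intro mult_right_mono) auto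
    then show ?thesis using n by linarith
  qed
  have a1: "a \<noteq> 1" using a pos by simp
  have cop: "coprime a n"
  proof (rule coprimeI)
    fix c assume c: "c dvd a" "c dvd n"
    have "c dvd q * a" using c(1) by simp
    then have "c dvd r" using c(2) unfolding n by (simp add: dvd_add_right_iff)
    then have "c dvd E * r" by simp
    then show "is_unit c" using c(1) unfolding a by (metis dvd_add_left_iff)
  qed
  have nadvd: "\<not> a dvd n" using coprime_not_dvd[OF cop a1] .
  have ad: "a \<noteq> d" using nadvd dn by auto
  have d1: "d \<noteq> 1"
  proof
    assume "d = 1"
    then have "n * 1 \<le> E * r" using Erd pos by (metis mult.right_neutral mult_le_mono2 Suc_leI One_nat_def)
    then show False using an a by simp
  qed
  define S where "S = {1, a, d}"
  have SS: "S \<subseteq> {1..n}" unfolding S_def using an a pos dn n0 by (auto dest: dvd_imp_le)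
  have z: "0 \<notin> S" using SS by auto
  have inS: "1 \<in> S" "a \<in> S" "d \<in> S" unfolding S_def by auto
  define K where "K = 1 + q * E"
  have nK: "n = q + r * K" unfolding n a K_def by (simp add: algebra_simps)
  have aK: "a * K = 1 + n * E"
  proof -
    have "a * K = a + q * a * E" unfolding K_def by (simp add: algebra_simps)
    then show ?thesis unfolding n by (simp add: a algebra_simps)
  qed
  have dv: "D dvd E" "D dvd e" unfolding D by auto
  have "index_one_mod n S D"
    unfolding index_one_mod_def
  proof (intro allI impI, rule ccontr)
    fix U i assume U: "atom n S U" "\<Sum>\<^sub># U = n * i" "\<not> int D dvd int i - 1"
    define N where "N = filter_mset (\<lambda>g. \<not> g dvd n) U"
    define L where "L = filter_mset (\<lambda>g. g dvd n \<and> d dvd g) U"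
    define P where "P = filter_mset (\<lambda>g. g dvd n \<and> \<not> d dvd g) U"
    have "\<exists>Y \<kappa>. \<Sum>\<^sub># N = a * Y \<and> K * \<Sum>\<^sub># P < n \<and> \<Sum>\<^sub># L < n \<and> n * \<kappa> = K * \<Sum>\<^sub># P + Y + \<Sum>\<^sub># L
        \<and> int D dvd int i - int \<kappa> \<and> \<kappa> \<in> {1, 2}"
      unfolding N_def L_def P_def K_def
    proof (rule atom_second_index[OF n a f fe dv pos(1,2) z, of "{1, d}" U i])
      show "atom n S U" "\<Sum>\<^sub># U = n * i" "\<not> int D dvd int i - 1" by (fact U)+
      show "x dvd y \<or> y dvd x" if "x \<in> {1, d}" "y \<in> {1, d}" for x y using that by auto
      show "g \<in> {1, d} \<and> (d dvd g \<or> g dvd q \<and> g dvd r)" if "g \<in> S" "g dvd n" for g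
        using that nadvd unfolding S_def by auto
      show "\<exists>s\<in>{1, d}. g = s * a \<and> s dvd q \<and> s dvd r" if "g \<in> S" "\<not> g dvd n" for g
        using that dn unfolding S_def by auto
    qed blast
    then obtain Y \<kappa> where k: "\<Sum>\<^sub># N = a * Y" "K * \<Sum>\<^sub># P < n" "\<Sum>\<^sub># L < n"
      "n * \<kappa> = K * \<Sum>\<^sub># P + Y + \<Sum>\<^sub># L" "int D dvd int i - int \<kappa>" "\<kappa> \<in> {1, 2}" by blast
    have "\<kappa> \<noteq> 1" using k(5) U(3) by auto
    then have k2: "n * 2 = K * \<Sum>\<^sub># P + Y + \<Sum>\<^sub># L" using k(4,6) by auto
    have US: "set_mset U \<subseteq> {1, a, d}" using U(1) unfolding atom_def zero_sum_def S_def by blast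
    have "set_mset P \<subseteq> {1, a}" unfolding P_def using US by auto
    moreover have "count P a = 0" unfolding P_def using nadvd by simp
    ultimately have sP: "\<Sum>\<^sub># P = count P 1" using sum_two[of P 1 a] a1 by simp
    have "count P 1 \<le> count U 1" unfolding P_def by simp
    then have xU: "\<Sum>\<^sub># P \<le> count U 1" using sP by simp
    have "set_mset N \<subseteq> {1, a}" unfolding N_def using US dn by auto
    moreover have "count N 1 = 0" unfolding N_def by simp
    ultimately have "\<Sum>\<^sub># N = count N a * a" using sum_two[of N 1 a] a1 by simp
    then have "a * count N a = a * Y" using k(1) by (simp only: mult.commute)
    moreover have "0 < a" using a by simp
    ultimately have "count N a = Y" by simp
    then have YU: "count U a = Y" unfolding N_def using nadvd by simp
    \<comment> \<open>For \<open>\<kappa> = 2\<close> the bound on \<open>L\<close> leaves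
      \<open>U\<close> with more than \<open>t\<close> copies of \<open>a\<close>. By
      \<open>a * K = 1 + n * E\<close>, \<open>t\<close> of them and the ones in \<open>P\<close>
      form a zero-sum sequence, which is proper.\<close>
    define t where "t = n - K * \<Sum>\<^sub># P"
    have t: "t + K * \<Sum>\<^sub># P = n" "0 < t" "t < Y" using k(2,3) k2 unfolding t_def by auto
    define T where "T = replicate_mset (\<Sum>\<^sub># P) 1 + replicate_mset t a"
    have "T \<subseteq># U" unfolding T_def
      by (rule mset_subset_eqI) (use xU YU t a1 in \<open>auto\<close>)
    moreover have "T \<noteq> {#}" unfolding T_def using t(2) by (cases t) auto
    moreover have "n dvd \<Sum>\<^sub># T"
    proof -
      have "\<Sum>\<^sub># T + n * (E * \<Sum>\<^sub># P) = a * t + (1 + n * E) * \<Sum>\<^sub># P"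
        unfolding T_def by (simp add: algebra_simps)
      also have "\<dots> = a * (t + K * \<Sum>\<^sub># P)" unfolding aK[symmetric] by (simp add: algebra_simps)
      also have "\<dots> = n * a" unfolding t(1) by simp
      finally have "n dvd \<Sum>\<^sub># T + n * (E * \<Sum>\<^sub># P)" by simp
      then show ?thesis by (simp add: dvd_add_left_iff)
    qed
    ultimately have "T = U" by (rule atom_subset_eq[OF U(1)])
    then have "count U a = t" unfolding T_def using a1 by auto
    then show False using YU t by simp
  qed
  then have 1: "D dvd min_dist n S" using dvd_min_dist_iff[OF n0 z] by metis
  define m where "m = min_dist n S"
  have gm: "index_one_mod n S m" unfolding m_def using dvd_min_dist_iff[OF n0 z] by (metis dvd_refl)
  have "int m dvd int (E + 1) - 1"
  proof -
    \<comment> \<open>An atom of index \<open>E + 1\<close>: weighting 1 by \<open>K\<close> and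
      \<open>a\<close> by 1, a nonempty zero-sum subsequence needs weight at least \<open>n\<close>,
      and \<open>M\<close> has weight exactly \<open>n\<close>.\<close>
    define M where "M = replicate_mset (r - 1) 1 + replicate_mset (K + q) a"
    have "\<Sum>\<^sub># M = r - 1 + (a * K + q * a)" unfolding M_def by (simp add: algebra_simps)
    then have sM: "\<Sum>\<^sub># M = n * (E + 1)" unfolding aK using n pos by simp
    have cM: "count M 1 = r - 1" "count M a = K + q" unfolding M_def using a1 by auto
    have setM: "set_mset M \<subseteq> {1, a}" unfolding M_def by (auto split: if_splits)
    have zM: "0 \<notin># M" using setM a by auto
    have "atom n S M"
    proof (rule atomI)
      show "zero_sum n S M" unfolding zero_sum_def using setM sM inS by auto
      show "M \<noteq> {#}" unfolding M_def using pos by (cases q) auto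
      fix T assume T: "T \<subseteq># M" "T \<noteq> {#}" "n dvd \<Sum>\<^sub># T"
      have sT: "set_mset T \<subseteq> {1, a}" using T setM by (meson mset_subset_eqD subset_iff)
      define x y where xy: "x = count T 1" "y = count T a"
      have sumT: "\<Sum>\<^sub># T = x + y * a" using sum_two[OF sT] a1 unfolding xy by simp
      have le: "x \<le> r - 1" "y \<le> K + q" using T(1) cM unfolding xy by (metis mset_subset_eq_count)+
      have "K * \<Sum>\<^sub># T = (K * x + y) + n * (E * y)"
      proof -
        have "K * \<Sum>\<^sub># T = K * x + (a * K) * y" unfolding sumT by (simp add: algebra_simps)
        then show ?thesis unfolding aK by (simp add: algebra_simps)
      qed
      then have "n dvd (K * x + y) + n * (E * y)" using T(3) by (metis dvd_mult)
      then have nd: "n dvd K * x + y" by (simp add: dvd_add_left_iff)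
      have "0 < \<Sum>\<^sub># T" using T(1,2) zM sum_mset_pos by (meson mset_subset_eqD)
      then have "0 < K * x + y" unfolding sumT K_def by (cases "x = 0") auto
      then have "n \<le> K * x + y" using nd by (rule dvd_imp_le[rotated])
      moreover have "K * x \<le> K * (r - 1)" using le by simp
      moreover have Kr: "K * (r - 1) + K = K * r" using pos by (cases r) auto
      moreover have "n = q + K * r" using nK by (simp add: mult.commute)
      ultimately have "y = K + q" "K * x = K * (r - 1)" using le by linarith+
      moreover have "0 < K" unfolding K_def by simp
      ultimately have "y = K + q" "x = r - 1" by auto
      then have "\<Sum>\<^sub># T = \<Sum>\<^sub># M" using sumT unfolding M_def by simp
      then show "T = M" using subset_eq_sum_eq[OF T(1) zM] by simp
    qed
    then show ?thesis using gm sM unfolding index_one_mod_def by blast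
  qed
  then have 2: "m dvd E" by simp
  \<comment> \<open>The atom of \<open>d\<close> copies of \<open>a\<close> and \<open>f - 1\<close>
    copies of \<open>d\<close> has index \<open>e + 1\<close>.\<close>
  have "int m dvd int (e + 1) - 1"
  proof -
    have af: "a + (f - 1) = f * (e + 1)" using a fe f0 by simp
    have "atom n S (replicate_mset d a + replicate_mset (f - 1) d)"
      by (rule coprime_divisor_atom[OF inS(2,3) z cop ad f n0]) (use f0 af in auto)
    moreover have "\<Sum>\<^sub># (replicate_mset d a + replicate_mset (f - 1) d) = d * (a + (f - 1))"
      by (simp add: algebra_simps)
    then have "\<Sum>\<^sub># (replicate_mset d a + replicate_mset (f - 1) d) = n * (e + 1)" unfolding af f by (simp only: mult.assoc)
    ultimately show ?thesis using gm unfolding index_one_mod_def by blast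
  qed
  then have "m dvd e" by simp
  with 2 have "m dvd D" unfolding D by simp
  with 1 have "min_dist n S = D" unfolding m_def by (rule dvd_antisym[rotated])
  moreover have "0 < D" using D pos by simp
  ultimately show ?thesis using that SS inS by blast
qed

section \<open>Descent from modulus p n to modulus n\<close>

lemma subset_plusE:
  assumes "T \<subseteq># A + B"
  obtains A' B' where "A' \<subseteq># A" "B' \<subseteq># B" "T = A' + B'"
proof -
  have "T = (T \<inter># A) + (T - A)" by (rule multiset_eqI) auto
  moreover have "T - A \<subseteq># B" using assms by (simp add: subset_eq_diff_conv add.commute)
  ultimately show ?thesis using that[of "T \<inter># A" "T - A"] by auto
qed

lemma subset_image_msetE:
  assumes "T \<subseteq># image_mset f W"
  obtains W' where "W' \<subseteq># W" "T = image_mset f W'"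
proof -
  obtain R where "image_mset f W = T + R" using assms by (metis subset_mset.le_iff_add)
  from image_mset_eq_plusD[OF this] obtain W' R' where "W = W' + R'" "T = image_mset f W'" by blast
  then show ?thesis using that[of W'] by simp
qed

lemma replicate_filter: "replicate_mset (count U x) x + filter_mset (\<lambda>y. y \<noteq> x) U = U"
  by (rule multiset_eqI) auto

text \<open>If \<open>p\<close> divides all other elements, ones occur in a zero-sum sequence only
  in multiples of \<open>p\<close>. The new 1 stands for a block of \<open>p\<close> old
  ones.\<close>

definition div_set :: "nat \<Rightarrow> nat set \<Rightarrow> nat set" where
  "div_set p S = insert 1 ((\<lambda>b. b div p) ` (S - {1}))"

context
  fixes p n :: nat and S :: "nat set"
  assumes pn: "0 < p" "0 < n" and S: "1 \<in> S" "0 \<notin> S" and S_dvd: "\<And>b. b \<in> S \<Longrightarrow> b \<noteq> 1 \<Longrightarrow> p dvd b"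
begin

lemma zero_notin_div_set: "0 \<notin> div_set p S"
proof -
  have "b div p \<noteq> 0" if "b \<in> S - {1}" for b
    using S_dvd[of b] S that pn by (metis DiffE dvd_div_eq_0_iff singletonI)
  then show ?thesis unfolding div_set_def by (auto simp: image_iff)
qed

text \<open>Each 1 becomes \<open>p\<close> ones and every other element is multiplied by
  \<open>p\<close>. A zero-sum subsequence of the result has a multiple of \<open>p\<close> ones, so
  it comes from a subsequence of \<open>V\<close>.\<close>

lemma atom_of_div_set:
  assumes V: "atom n (div_set p S) V" "\<Sum>\<^sub># V = n * i"
  obtains U where "atom (p * n) S U" "\<Sum>\<^sub># U = p * n * i"
proof -
  define c where "c = count V 1"
  define W where "W = filter_mset (\<lambda>y. y \<noteq> 1) V"
  have V_eq: "replicate_mset c 1 + W = V" unfolding c_def W_def by (rule replicate_filter)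
  define U where "U = replicate_mset (p * c) 1 + image_mset ((*) p) W"
  have sum_lift: "\<Sum>\<^sub># (image_mset ((*) p) X) = p * \<Sum>\<^sub># X" for X :: "nat multiset"
    by (induction X) (auto simp: algebra_simps)
  have "\<Sum>\<^sub># U = p * \<Sum>\<^sub># V"
    unfolding U_def V_eq[symmetric] by (simp add: sum_lift algebra_simps)
  then have sU: "\<Sum>\<^sub># U = p * n * i" using V(2) by simp
  have VS: "set_mset V \<subseteq> div_set p S" and Vne: "V \<noteq> {#}" using V(1) unfolding atom_def zero_sum_def by auto
  have "p * w \<in> S" if "w \<in># W" for w
  proof -
    have "w \<in> (\<lambda>b. b div p) ` (S - {1})" using that VS unfolding W_def div_set_def by auto
    then obtain b where b: "b \<in> S" "b \<noteq> 1" "w = b div p" by auto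
    then show ?thesis using S_dvd[OF b(1,2)] by simp
  qed
  then have US: "set_mset U \<subseteq> S" unfolding U_def using S by auto
  have "atom (p * n) S U"
  proof (rule atomI)
    show "zero_sum (p * n) S U" unfolding zero_sum_def using US sU by simp
    have "0 < \<Sum>\<^sub># V" using sum_mset_pos[OF Vne] VS zero_notin_div_set by blast
    then have "0 < \<Sum>\<^sub># U" using \<open>\<Sum>\<^sub># U = p * \<Sum>\<^sub># V\<close> pn by (metis nat_0_less_mult_iff)
    then show "U \<noteq> {#}" by auto
    fix T assume T: "T \<subseteq># U" "T \<noteq> {#}" "p * n dvd \<Sum>\<^sub># T"
    obtain T1 T2 where T12: "T1 \<subseteq># replicate_mset (p * c) 1" "T2 \<subseteq># image_mset ((*) p) W" "T = T1 + T2"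
      using subset_plusE T(1) unfolding U_def by blast
    obtain j where j: "j \<le> p * c" "T1 = replicate_mset j 1" using T12(1) by (rule msubseteq_replicate_msetE)
    obtain W' where W': "W' \<subseteq># W" "T2 = image_mset ((*) p) W'" using T12(2) by (rule subset_image_msetE)
    have sT: "\<Sum>\<^sub># T = j + p * \<Sum>\<^sub># W'" unfolding T12(3) j(2) W'(2) by (simp add: sum_lift)
    have "p dvd j + p * \<Sum>\<^sub># W'" using T(3) unfolding sT by (metis dvd_mult_left)
    then have "p dvd j" by (simp add: dvd_add_left_iff)
    then obtain j' where j': "j = p * j'" by (elim dvdE)
    define V' where "V' = replicate_mset j' 1 + W'"
    have "j' \<le> c" using j(1) j' pn by simp
    then have "V' \<subseteq># V" unfolding V'_def V_eq[symmetric] using W'(1)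
      by (intro subset_mset.add_mono) (auto simp: replicate_mset_msubseteq_iff)
    moreover have sT': "\<Sum>\<^sub># T = p * \<Sum>\<^sub># V'" unfolding sT j' V'_def by (simp add: algebra_simps)
    have "n dvd \<Sum>\<^sub># V'" using T(3) pn unfolding sT' by simp
    moreover have "0 \<notin># T" using T(1) US S by (meson mset_subset_eqD subsetD)
    then have "0 < \<Sum>\<^sub># T" by (rule sum_mset_pos[OF T(2)])
    then have "V' \<noteq> {#}" unfolding sT' by auto
    ultimately have "V' = V" using atom_subset_eq[OF V(1)] by blast
    then have "\<Sum>\<^sub># T = \<Sum>\<^sub># U" using sT' \<open>\<Sum>\<^sub># U = p * \<Sum>\<^sub># V\<close> by simp
    then show "T = U" using subset_eq_sum_eq[OF T(1)] US S by auto
  qed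
  then show ?thesis using sU by (rule that)
qed

text \<open>\<open>p\<close> divides the sum and all terms other than 1, hence also the number of
  ones, which can be bundled in blocks of \<open>p\<close>. An element \<open>p\<close> of
  \<open>S\<close> becomes 1 as well, so the two sources of ones are kept apart when splitting
  \<open>T\<close>.\<close>

lemma atom_to_div_set:
  assumes U: "atom (p * n) S U" "\<Sum>\<^sub># U = p * n * i"
  obtains V where "atom n (div_set p S) V" "\<Sum>\<^sub># V = n * i"
proof -
  define W where "W = filter_mset (\<lambda>y. y \<noteq> 1) U"
  have U_eq: "replicate_mset (count U 1) 1 + W = U" unfolding W_def by (rule replicate_filter)
  have US: "set_mset U \<subseteq> S" and Une: "U \<noteq> {#}" using U(1) unfolding atom_def zero_sum_def by auto
  have pW: "p dvd w" if "w \<in># W" for w using that US S_dvd unfolding W_def by auto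
  have sum_div: "p * \<Sum>\<^sub># (image_mset (\<lambda>b. b div p) X) = \<Sum>\<^sub># X" if "X \<subseteq># W" for X
  proof -
    have "\<And>w. w \<in># X \<Longrightarrow> p dvd w" using pW that by (meson mset_subset_eqD)
    then show ?thesis by (induction X) (auto simp: algebra_simps)
  qed
  have sumU: "count U 1 + \<Sum>\<^sub># W = \<Sum>\<^sub># U"
  proof -
    have "\<Sum>\<^sub># (replicate_mset (count U 1) 1 + W) = count U 1 + \<Sum>\<^sub># W" by simp
    then show ?thesis unfolding U_eq by simp
  qed
  have "p dvd \<Sum>\<^sub># W" using pW by (rule sum_mset_dvd)
  moreover have "p dvd count U 1 + \<Sum>\<^sub># W" unfolding sumU U(2) by simp
  ultimately have "p dvd count U 1" by (simp add: dvd_add_left_iff)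
  then obtain c where c: "count U 1 = p * c" by (elim dvdE)
  define V where "V = replicate_mset c 1 + image_mset (\<lambda>b. b div p) W"
  have pV: "p * \<Sum>\<^sub># V = \<Sum>\<^sub># U"
    unfolding V_def sumU[symmetric] c using sum_div[of W] by (simp add: algebra_simps)
  then have sV: "\<Sum>\<^sub># V = n * i" using U(2) pn by simp
  have VS: "set_mset V \<subseteq> div_set p S" unfolding V_def div_set_def W_def using US by (auto split: if_splits)
  have zV: "0 \<notin># V" using VS zero_notin_div_set by blast
  have "atom n (div_set p S) V"
  proof (rule atomI)
    show "zero_sum n (div_set p S) V" unfolding zero_sum_def using VS sV by simp
    have "0 < \<Sum>\<^sub># U" using sum_mset_pos[OF Une] US S by blast
    then have "\<Sum>\<^sub># V \<noteq> 0" unfolding pV[symmetric] by (metis mult_0_right less_irrefl)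
    then show "V \<noteq> {#}" by (metis sum_mset.empty)
    fix T assume T: "T \<subseteq># V" "T \<noteq> {#}" "n dvd \<Sum>\<^sub># T"
    obtain T1 T2 where T12: "T1 \<subseteq># replicate_mset c 1" "T2 \<subseteq># image_mset (\<lambda>b. b div p) W" "T = T1 + T2"
      using subset_plusE T(1) unfolding V_def by blast
    obtain j where j: "j \<le> c" "T1 = replicate_mset j 1" using T12(1) by (rule msubseteq_replicate_msetE)
    obtain W' where W': "W' \<subseteq># W" "T2 = image_mset (\<lambda>b. b div p) W'" using T12(2) by (rule subset_image_msetE)
    define U' where "U' = replicate_mset (p * j) 1 + W'"
    have "U' \<subseteq># replicate_mset (count U 1) 1 + W" unfolding U'_def c using W'(1) j(1)
      by (intro subset_mset.add_mono) (auto simp: replicate_mset_msubseteq_iff)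
    then have "U' \<subseteq># U" unfolding U_eq .
    moreover have sT: "\<Sum>\<^sub># U' = p * \<Sum>\<^sub># T"
      unfolding U'_def T12(3) j(2) W'(2) using sum_div[OF W'(1)] by (simp add: algebra_simps)
    have "p * n dvd \<Sum>\<^sub># U'" using T(3) unfolding sT by simp
    moreover have "0 \<notin># T" using T(1) zV by (meson mset_subset_eqD)
    then have "0 < \<Sum>\<^sub># T" by (rule sum_mset_pos[OF T(2)])
    then have "0 < \<Sum>\<^sub># U'" unfolding sT using pn by simp
    then have "U' \<noteq> {#}" by auto
    ultimately have "U' = U" using atom_subset_eq[OF U(1)] by blast
    then have "p * \<Sum>\<^sub># T = p * \<Sum>\<^sub># V" using sT pV by metis
    then have "\<Sum>\<^sub># T = \<Sum>\<^sub># V" using pn by simp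
    then show "T = V" using subset_eq_sum_eq[OF T(1) zV] by simp
  qed
  then show ?thesis using sV by (rule that)
qed

lemma min_dist_div_set: "min_dist (p * n) S = min_dist n (div_set p S)"
proof -
  have "(\<exists>U. atom (p * n) S U \<and> \<Sum>\<^sub># U = p * n * i) \<longleftrightarrow> (\<exists>V. atom n (div_set p S) V \<and> \<Sum>\<^sub># V = n * i)" for i
    by (metis atom_of_div_set atom_to_div_set)
  then have "{i - 1 | i U. atom (p * n) S U \<and> \<Sum>\<^sub># U = p * n * i}
      = {i - 1 | i U. atom n (div_set p S) U \<and> \<Sum>\<^sub># U = n * i}"
    by (intro Collect_cong) metis
  then show ?thesis unfolding min_dist_def by simp
qed

end

lemma min_dist_one: "min_dist 1 {1} = 0"
proof -
  have "index_one_mod 1 {1} 0"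
    unfolding index_one_mod_def
  proof (intro allI impI)
    fix U i assume U: "atom 1 {1} U" "\<Sum>\<^sub># U = 1 * i"
    have "U \<noteq> {#}" "set_mset U \<subseteq> {1}" using U(1) unfolding atom_def zero_sum_def by auto
    then have "{#1#} \<subseteq># U" by (metis mset_subset_eq_single multiset_nonemptyE singletonD subset_iff)
    then have "{#1#} = U" by (rule atom_subset_eq[OF U(1)]) auto
    then show "int 0 dvd int i - 1" using U(2) by auto
  qed
  then show ?thesis using dvd_min_dist_iff[of 1 "{1}" 0] by simp
qed

lemma prime_power_divisors_chain:
  fixes p :: nat
  assumes "prime p" "x dvd p ^ k" "y dvd p ^ k"
  shows "x dvd y \<or> y dvd x"
proof -
  obtain i j where "x = p ^ i" "y = p ^ j" using assms by (metis divides_primepow_nat)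
  then show ?thesis by (metis le_imp_power_dvd nat_le_linear)
qed

text \<open>Induction on the exponent: either a second residue coprime to \<open>p\<close> exists
  and \<open>coprime_case\<close> applies, or the descent keeps the gcd while the modulus, and with
  it the lower bound, shrinks.\<close>

theorem large_min_dist_in_I_set:
  assumes p: "prime p" and S: "S \<subseteq> {1..p ^ k}" "1 \<in> S" and D: "0 < min_dist (p ^ k) S"
    "2 * p ^ k \<le> min_dist (p ^ k) S * min_dist (p ^ k) S"
  shows "\<exists>m. m dvd p ^ k \<and> min_dist (p ^ k) S \<in> I_set m"
  using S D
proof (induction k arbitrary: S)
  case 0
  then have "S = {1}" by auto
  then show ?case using min_dist_one 0 by simp
next
  case (Suc k)
  define n where "n = p ^ Suc k"
  define D where "D = min_dist n S"
  have p0: "0 < p" using p by (rule prime_gt_0_nat)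
  have n0: "0 < n" unfolding n_def using p0 by simp
  have z: "0 \<notin> S" using Suc.prems by auto
  show ?case
  proof (cases "\<exists>a\<in>S. a \<noteq> 1 \<and> coprime a n")
    case True
    then obtain a where a: "a \<in> S" "a \<noteq> 1" "coprime a n" by blast
    have gD: "index_one_mod n S D" unfolding D_def using dvd_min_dist_iff[OF n0 z] by (metis dvd_refl)
    interpret large_gap n S D
      by unfold_locales (use Suc.prems n0 gD in \<open>auto simp: n_def D_def\<close>)
    have chain: "x dvd y \<or> y dvd x" if "x dvd n" "y dvd n" for x y
      using prime_power_divisors_chain[OF p] that unfolding n_def by blast
    obtain D0 where D0: "D0 \<in> I_set n" "D dvd D0" "index_one_mod n S D0"
      using coprime_case[OF a] chain by metis
    have "D0 dvd D" unfolding D_def using D0(3) dvd_min_dist_iff[OF n0 z] by metis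
    then have "D0 = D" using D0(2) by (rule dvd_antisym)
    then show ?thesis using D0(1) unfolding D_def n_def by (intro exI[of _ "p ^ Suc k"]) simp
  next
    case False
    have pd: "p dvd b" if "b \<in> S" "b \<noteq> 1" for b
    proof -
      have "\<not> coprime b (p ^ Suc k)" using False that unfolding n_def by blast
      then have "\<not> coprime b p" by (metis coprime_power_right_iff)
      then show ?thesis using p by (metis coprime_commute prime_imp_coprime)
    qed
    have pk: "0 < p ^ k" using p0 by simp
    define S' where "S' = div_set p S"
    have md: "min_dist (p ^ k) S' = min_dist (p ^ Suc k) S"
      unfolding S'_def using min_dist_div_set[OF p0 pk Suc.prems(2) z pd] by simp
    have "S' \<subseteq> {1..p ^ k}"
    proof
      fix x assume x: "x \<in> S'"
      have "x \<noteq> 0" using x zero_notin_div_set[OF p0 pk Suc.prems(2) z pd] unfolding S'_def by metis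
      moreover have "x \<le> p ^ k"
      proof (cases "x = 1")
        case True
        then show ?thesis using pk by linarith
      next
        case False
        then obtain b where b: "b \<in> S" "x = b div p" using x unfolding S'_def div_set_def by auto
        have "b \<le> p * p ^ k" using b(1) Suc.prems(1) by auto
        then have "b div p \<le> p * p ^ k div p" by (rule div_le_mono)
        then show ?thesis using b(2) p0 by simp
      qed
      ultimately show "x \<in> {1..p ^ k}" by simp
    qed
    moreover have "1 \<in> S'" unfolding S'_def div_set_def by simp
    moreover have "2 * p ^ k \<le> min_dist (p ^ k) S' * min_dist (p ^ k) S'"
    proof -
      have "p ^ k \<le> p ^ Suc k" using p0 by simp
      then show ?thesis using Suc.prems(4) unfolding md by linarith
    qed
    ultimately obtain m where "m dvd p ^ k" "min_dist (p ^ k) S' \<in> I_set m"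
      using Suc.IH[of S'] Suc.prems(3) md by auto
    then show ?thesis unfolding md by (metis dvd_mult power_Suc)
  qed
qed

section \<open>Transfer to cyclic groups\<close>

lemma atom_of_sum_eq:
  assumes "set_mset V \<subseteq> S" "\<Sum>\<^sub># V = n" "0 < n" "0 \<notin> S"
  shows "atom n S V"
proof (rule atomI)
  show "zero_sum n S V" unfolding zero_sum_def using assms by simp
  show "V \<noteq> {#}" using assms by auto
  fix T assume T: "T \<subseteq># V" "T \<noteq> {#}" "n dvd \<Sum>\<^sub># T"
  have z: "0 \<notin># V" using assms by auto
  then have "0 \<notin># T" using T by (meson mset_subset_eqD)
  then have "0 < \<Sum>\<^sub># T" by (rule sum_mset_pos[OF T(2)])
  then have "\<Sum>\<^sub># V \<le> \<Sum>\<^sub># T" using T(3) assms(2) by (simp add: dvd_imp_le)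
  then show "T = V" by (rule subset_eq_sum_eq[OF T(1) z])
qed

lemma sum_image_mset_count:
  fixes f :: "'a \<Rightarrow> nat"
  shows "\<Sum>\<^sub># (image_mset f M) = (\<Sum>x\<in>set_mset M. f x * count M x)"
proof (induction M)
  case (add y M)
  have "(\<Sum>x\<in>set_mset (add_mset y M). f x * count (add_mset y M) x)
      = (\<Sum>x\<in>insert y (set_mset M). f x * count M x + (if x = y then f y else 0))"
    by (intro sum.cong) auto
  also have "\<dots> = (\<Sum>x\<in>insert y (set_mset M). f x * count M x) + f y"
    by (simp add: sum.distrib)
  also have "(\<Sum>x\<in>insert y (set_mset M). f x * count M x) = (\<Sum>x\<in>set_mset M. f x * count M x)"
    by (rule sum.mono_neutral_right) (auto simp: not_in_iff)
  finally show ?case using add by simp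
qed simp

lemma (in comm_group) finprod_pow_sum:
  assumes "finite A" "c \<in> carrier G"
  shows "(\<Otimes>x\<in>A. c [^] (f x :: nat)) = c [^] (\<Sum>x\<in>A. f x)"
  using assms(1) by (induction A) (use assms(2) in \<open>auto simp: nat_pow_mult\<close>)

text \<open>\<open>\<psi>\<close> is a discrete logarithm to the base \<open>c\<close> with values
  from 1 to \<open>ord c\<close>. The identity receives \<open>ord c\<close> instead of 0, so every
  term counts positively.\<close>

locale log_set = comm_group G for G (structure) +
  fixes G0 :: "'a set" and c :: 'a and \<psi> :: "'a \<Rightarrow> nat"
  assumes c: "c \<in> G0" and G0: "G0 \<subseteq> carrier G" and ord_pos: "0 < ord c" and \<psi>_c: "\<psi> c = 1"
    and \<psi>: "\<And>g. g \<in> G0 \<Longrightarrow> 1 \<le> \<psi> g \<and> \<psi> g \<le> ord c \<and> c [^] \<psi> g = g"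
begin

abbreviation "n \<equiv> ord c"
abbreviation "dlog \<equiv> image_mset \<psi>"

lemma S_facts: "0 \<notin> \<psi> ` G0" "1 \<in> \<psi> ` G0" "\<psi> ` G0 \<subseteq> {1..n}"
  using \<psi> \<psi>_c c by (force simp: image_iff)+

lemma zero_sum_seqs_iff: "M \<in> zero_sum_seqs G G0 \<longleftrightarrow> set_mset M \<subseteq> G0 \<and> n dvd \<Sum>\<^sub># (dlog M)"
proof (cases "set_mset M \<subseteq> G0")
  case True
  have cc: "c \<in> carrier G" using c G0 by auto
  have "seq_sum G M = (\<Otimes>g\<in>set_mset M. c [^] (\<psi> g * count M g))"
    unfolding seq_sum_def
  proof (rule finprod_cong')
    show "(\<lambda>g. c [^] (\<psi> g * count M g)) \<in> set_mset M \<rightarrow> carrier G" using cc by auto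
    fix g assume "g \<in> set_mset M"
    then have "g \<in> G0" using True by auto
    then show "g [^] count M g = c [^] (\<psi> g * count M g)"
      using \<psi>[of g] cc by (metis nat_pow_pow)
  qed simp
  also have "\<dots> = c [^] \<Sum>\<^sub># (dlog M)"
    unfolding sum_image_mset_count using cc by (intro finprod_pow_sum) auto
  finally have "seq_sum G M = c [^] \<Sum>\<^sub># (dlog M)" .
  then show ?thesis unfolding zero_sum_seqs_def using True pow_eq_id[OF cc] by simp
qed (auto simp: zero_sum_seqs_def)

lemma log_subset: "set_mset M \<subseteq> G0 \<Longrightarrow> set_mset (dlog M) \<subseteq> \<psi> ` G0"
  by auto

lemma zero_sum_seqs_iff_zero_sum: "M \<in> zero_sum_seqs G G0 \<longleftrightarrow> set_mset M \<subseteq> G0 \<and> zero_sum n (\<psi> ` G0) (dlog M)"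
  using zero_sum_seqs_iff log_subset unfolding zero_sum_def by blast

lemma min_zero_sum_seqs_iff:
  "U \<in> min_zero_sum_seqs G G0 \<longleftrightarrow> set_mset U \<subseteq> G0 \<and> atom n (\<psi> ` G0) (dlog U)"
proof
  assume U: "U \<in> min_zero_sum_seqs G G0"
  then have z: "set_mset U \<subseteq> G0" "zero_sum n (\<psi> ` G0) (dlog U)" "U \<noteq> {#}"
    and m: "\<And>T. T \<subset># U \<Longrightarrow> T \<noteq> {#} \<Longrightarrow> T \<notin> zero_sum_seqs G G0"
    unfolding min_zero_sum_seqs_def zero_sum_seqs_iff_zero_sum by auto
  have "atom n (\<psi> ` G0) (dlog U)"
  proof (rule atomI)
    fix T assume T: "T \<subseteq># dlog U" "T \<noteq> {#}" "n dvd \<Sum>\<^sub># T"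
    obtain T' where T': "T' \<subseteq># U" "T = dlog T'" using T(1) by (rule subset_image_msetE)
    have "set_mset T' \<subseteq> G0" using T'(1) z(1) by (meson set_mset_mono subset_trans)
    then have "T' \<in> zero_sum_seqs G G0" using T(3) unfolding T'(2) zero_sum_seqs_iff by simp
    then have "T' = U" using m[of T'] T(2) T' by (auto simp: subset_mset.le_less)
    then show "T = dlog U" using T' by simp
  qed (use z in auto)
  then show "set_mset U \<subseteq> G0 \<and> atom n (\<psi> ` G0) (dlog U)" using z by simp
next
  assume U: "set_mset U \<subseteq> G0 \<and> atom n (\<psi> ` G0) (dlog U)"
  show "U \<in> min_zero_sum_seqs G G0"
    unfolding min_zero_sum_seqs_def
  proof (intro CollectI conjI allI impI)
    show "U \<in> zero_sum_seqs G G0" using U unfolding zero_sum_seqs_iff_zero_sum atom_def by blast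
    show "U \<noteq> {#}" using U unfolding atom_def by auto
    fix T assume T: "T \<subset># U \<and> T \<noteq> {#}"
    have "dlog T \<subset># dlog U" using T by (simp add: image_mset_subset_mono)
    moreover have "dlog T \<noteq> {#}" using T by simp
    ultimately have "\<not> n dvd \<Sum>\<^sub># (dlog T)" using U unfolding atom_def by blast
    then show "T \<notin> zero_sum_seqs G G0" unfolding zero_sum_seqs_iff by simp
  qed
qed

lemma log_Union: "dlog (\<Sum>\<^sub># F) = \<Sum>\<^sub># (image_mset dlog F)"
  by (induction F) auto

section \<open>Lengths of factorizations and distances\<close>

lemma lengths_index:
  assumes "l \<in> factorization_lengths G G0 B"
  obtains i where "\<Sum>\<^sub># (dlog B) = n * i" "int (min_dist n (\<psi> ` G0)) dvd int i - int l"
proof -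
  obtain F where F: "set_mset F \<subseteq> min_zero_sum_seqs G G0" "\<Sum>\<^sub># F = B" "l = size F"
    using assms unfolding factorization_lengths_def by blast
  have at: "set_mset (image_mset dlog F) \<subseteq> Collect (atom n (\<psi> ` G0))"
    using F(1) min_zero_sum_seqs_iff by auto
  have "index_one_mod n (\<psi> ` G0) (min_dist n (\<psi> ` G0))"
    using dvd_min_dist_iff[OF ord_pos S_facts(1)] by (metis dvd_refl)
  then obtain i where "\<Sum>\<^sub># (\<Sum>\<^sub># (image_mset dlog F)) = n * i"
    "int (min_dist n (\<psi> ` G0)) dvd int i - int (size (image_mset dlog F))"
    using factorization_index[OF at ord_pos S_facts(1)] by metis
  moreover have "\<Sum>\<^sub># (image_mset dlog F) = dlog B" using F(2) log_Union by metis
  ultimately show ?thesis using that[of i] F(3) by simp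
qed

lemma min_dist_dvd_distance:
  assumes "d \<in> distances G G0"
  shows "min_dist n (\<psi> ` G0) dvd d" "0 < d"
proof -
  obtain B l l' where l: "l \<in> factorization_lengths G G0 B" "l' \<in> factorization_lengths G G0 B"
    "l < l'" "d = l' - l"
    using assms unfolding distances_def successive_distances_def by blast
  obtain i where i: "\<Sum>\<^sub># (dlog B) = n * i" "int (min_dist n (\<psi> ` G0)) dvd int i - int l"
    using lengths_index[OF l(1)] by blast
  obtain j where j: "\<Sum>\<^sub># (dlog B) = n * j" "int (min_dist n (\<psi> ` G0)) dvd int j - int l'"
    using lengths_index[OF l(2)] by blast
  have "j = i" using i j ord_pos by simp
  then have "int (min_dist n (\<psi> ` G0)) dvd int i - int l'" using j by simp
  then have "int (min_dist n (\<psi> ` G0)) dvd (int i - int l) - (int i - int l')"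
    using i(2) by (rule dvd_diff[rotated])
  moreover have "(int i - int l) - (int i - int l') = int d" using l by simp
  ultimately show "min_dist n (\<psi> ` G0) dvd d" by (metis of_nat_dvd_iff)
  show "0 < d" using l by simp
qed

lemma distance_le:
  assumes "B \<in> zero_sum_seqs G G0" "l \<in> factorization_lengths G G0 B"
    "l' \<in> factorization_lengths G G0 B" "l < l'"
  obtains d where "d \<in> distances G G0" "d \<le> l' - l"
proof -
  define m where "m = (LEAST m. m \<in> factorization_lengths G G0 B \<and> l < m)"
  have m: "m \<in> factorization_lengths G G0 B \<and> l < m" unfolding m_def
    by (rule LeastI[of _ l']) (use assms in auto)
  have ml: "m \<le> l'" unfolding m_def by (rule Least_le) (use assms in auto)
  have "{l<..<m} \<inter> factorization_lengths G G0 B = {}"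
    using not_less_Least unfolding m_def by fastforce
  then have "m - l \<in> successive_distances (factorization_lengths G G0 B)"
    unfolding successive_distances_def using assms m by blast
  then have "m - l \<in> distances G G0" unfolding distances_def using assms by blast
  then show ?thesis using that ml by (meson diff_le_mono)
qed

lemma lengths_add:
  assumes "l \<in> factorization_lengths G G0 B" "l' \<in> factorization_lengths G G0 B'"
  shows "l + l' \<in> factorization_lengths G G0 (B + B')"
proof -
  obtain F F' where F: "set_mset F \<subseteq> min_zero_sum_seqs G G0" "\<Sum>\<^sub># F = B" "l = size F"
    "set_mset F' \<subseteq> min_zero_sum_seqs G G0" "\<Sum>\<^sub># F' = B'" "l' = size F'"
    using assms unfolding factorization_lengths_def by blast
  then show ?thesis unfolding factorization_lengths_def
    by (intro CollectI exI[of _ "F + F'"]) auto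
qed

lemma lengths_repeat:
  assumes "l \<in> factorization_lengths G G0 B"
  shows "k * l \<in> factorization_lengths G G0 (repeat_mset k B)"
proof (induction k)
  case 0
  then show ?case unfolding factorization_lengths_def by (intro CollectI exI[of _ "{#}"]) auto
next
  case (Suc k)
  then show ?case using lengths_add[OF assms Suc] by simp
qed

lemma zero_sum_seqs_of_length:
  assumes "l \<in> factorization_lengths G G0 B"
  shows "B \<in> zero_sum_seqs G G0"
proof -
  obtain F where F: "set_mset F \<subseteq> min_zero_sum_seqs G G0" "\<Sum>\<^sub># F = B"
    using assms unfolding factorization_lengths_def by blast
  obtain i where "\<Sum>\<^sub># (dlog B) = n * i" using lengths_index[OF assms] by blast
  moreover have "set_mset B \<subseteq> G0" using F min_zero_sum_seqs_iff by fastforce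
  ultimately show ?thesis unfolding zero_sum_seqs_iff by simp
qed

text \<open>If \<open>d\<close> left a remainder \<open>r\<close>, subtracting \<open>q\<close>
  differences \<open>d\<close> realized by powers of \<open>B1\<close> would produce two lengths at
  difference \<open>r < d\<close>, hence a distance below the least one.\<close>

lemma least_distance_dvd:
  assumes ne: "distances G G0 \<noteq> {}"
    and l: "l \<in> factorization_lengths G G0 B" "l' \<in> factorization_lengths G G0 B" "l < l'"
  shows "(LEAST d. d \<in> distances G G0) dvd l' - l"
proof (rule ccontr)
  define d where "d = (LEAST d. d \<in> distances G G0)"
  assume "\<not> (LEAST d. d \<in> distances G G0) dvd l' - l"
  then have nd: "\<not> d dvd l' - l" unfolding d_def .
  have "d \<in> distances G G0" unfolding d_def using ne by (metis LeastI ex_in_conv)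
  then obtain B1 m m' where m: "m \<in> factorization_lengths G G0 B1" "m' \<in> factorization_lengths G G0 B1"
    "m < m'" "d = m' - m"
    unfolding distances_def successive_distances_def by blast
  define q where "q = (l' - l) div d"
  define r where "r = (l' - l) mod d"
  have qr: "l' = l + q * d + r" unfolding q_def r_def using l(3) by simp
  have r: "0 < r" using nd unfolding r_def by (simp add: dvd_eq_mod_eq_0)
  have rd: "r < d" unfolding r_def using m by simp
  \<comment> \<open>The two lengths cross over: the larger length of \<open>B\<close> goes with the
    smaller one of \<open>B1\<close>, and conversely.\<close>
  have a1: "q * m + l' \<in> factorization_lengths G G0 (repeat_mset q B1 + B)"
    by (rule lengths_add[OF lengths_repeat[OF m(1)] l(2)])
  have a2: "q * m' + l \<in> factorization_lengths G G0 (repeat_mset q B1 + B)"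
    by (rule lengths_add[OF lengths_repeat[OF m(2)] l(1)])
  have "m' = m + d" using m by simp
  then have "q * m' = q * m + q * d" by (simp add: algebra_simps)
  then have diff: "q * m + l' = (q * m' + l) + r" using qr by simp
  have "q * m' + l < q * m + l'" using diff r by simp
  then obtain e where e: "e \<in> distances G G0" "e \<le> (q * m + l') - (q * m' + l)"
    using distance_le[OF zero_sum_seqs_of_length[OF a1] a2 a1] by blast
  have "d \<le> e" unfolding d_def using e(1) by (rule Least_le)
  then show False using e(2) diff rd by simp
qed

text \<open>Multiplying an atom \<open>U\<close> by a suitable power of \<open>c\<close> and regrouping every \<open>g\<close> with \<open>n - \<psi> g\<close>
  copies of \<open>c\<close> changes the length by the index of \<open>U\<close> minus one.\<close>

lemma atom_lengths:
  assumes V: "atom n (\<psi> ` G0) V" "\<Sum>\<^sub># V = n * i"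
  obtains B l where "l \<in> factorization_lengths G G0 B" "l + (i - 1) \<in> factorization_lengths G G0 B"
proof -
  define U where "U = image_mset (\<lambda>b. c [^] b) V"
  have VS: "set_mset V \<subseteq> \<psi> ` G0" using V(1) unfolding atom_def zero_sum_def by blast
  have inG0: "c [^] b \<in> G0 \<and> \<psi> (c [^] b) = b" if "b \<in># V" for b
    using that VS \<psi> by (metis imageE subsetD)
  have UG: "set_mset U \<subseteq> G0" unfolding U_def using inG0 by auto
  have "dlog U = image_mset (\<lambda>b. b) V"
    unfolding U_def image_mset.compositionality by (rule image_mset_cong) (use inG0 in auto)
  then have logU: "dlog U = V" by simp
  have Uat: "U \<in> min_zero_sum_seqs G G0" unfolding min_zero_sum_seqs_iff using UG V(1) logU by simp
  have i1: "1 \<le> i"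
    using atom_index[OF V(1) ord_pos S_facts(1)] V(2) ord_pos by (metis One_nat_def Suc_leI mult_cancel1 not_gr0)
  define W where "W = (\<lambda>g. add_mset g (replicate_mset (n - \<psi> g) c))"
  have one: "X \<in> min_zero_sum_seqs G G0" if "set_mset X \<subseteq> G0" "\<Sum>\<^sub># (dlog X) = n" for X
    unfolding min_zero_sum_seqs_iff
    using that(1) atom_of_sum_eq[OF log_subset[OF that(1)] that(2) ord_pos S_facts(1)] by simp
  have Wat: "W g \<in> min_zero_sum_seqs G G0" if "g \<in> G0" for g
    by (rule one) (use that c \<psi>[OF that] \<psi>_c in \<open>auto simp: W_def\<close>)
  have cat: "replicate_mset n c \<in> min_zero_sum_seqs G G0"
    by (rule one) (use c \<psi>_c in \<open>auto split: if_splits\<close>)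
  have W_sum: "\<Sum>\<^sub># (image_mset W X) = X + replicate_mset (\<Sum>\<^sub># (image_mset (\<lambda>g. n - \<psi> g) X)) c" for X
    by (induction X) (auto simp: W_def intro!: multiset_eqI)
  have tot: "\<Sum>\<^sub># (image_mset (\<lambda>g. n - \<psi> g) X) + \<Sum>\<^sub># (dlog X) = n * size X" if "set_mset X \<subseteq> G0" for X
    using that
  proof (induction X)
    case (add g X)
    then show ?case using \<psi>[of g] by (auto simp: algebra_simps)
  qed simp
  \<comment> \<open>The number of added copies of \<open>c\<close> is
    \<open>n * (size U - i)\<close>, so they form \<open>size U - i\<close> atoms besides
    \<open>U\<close> itself.\<close>
  have eq: "\<Sum>\<^sub># (image_mset (\<lambda>g. n - \<psi> g) U) + n * i = n * size U" using tot[OF UG] logU V(2) by simp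
  then have "n * i \<le> n * size U" by linarith
  then have iU: "i \<le> size U" using ord_pos by simp
  have eq': "\<Sum>\<^sub># (image_mset (\<lambda>g. n - \<psi> g) U) = (size U - i) * n"
    using eq unfolding diff_mult_distrib by (metis add_diff_cancel_right' mult.commute)
  have rep: "\<Sum>\<^sub># (replicate_mset k (replicate_mset n c)) = replicate_mset (k * n) c" for k
    by (induction k) (auto intro!: multiset_eqI)
  define B where "B = \<Sum>\<^sub># (image_mset W U)"
  have "size U \<in> factorization_lengths G G0 B"
    unfolding factorization_lengths_def B_def
    by (intro CollectI exI[of _ "image_mset W U"]) (use Wat UG in auto)
  moreover have "Suc (size U - i) \<in> factorization_lengths G G0 B"
    unfolding factorization_lengths_def B_def W_sum eq'
    by (intro CollectI exI[of _ "add_mset U (replicate_mset (size U - i) (replicate_mset n c))"])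
      (use Uat cat rep in \<open>auto split: if_splits\<close>)
  moreover have "size U = Suc (size U - i) + (i - 1)" using iU i1 by simp
  ultimately show ?thesis using that by metis
qed

text \<open>Lengths of one product are all congruent to its index, so the gcd divides every
  distance. Conversely \<open>atom_lengths\<close> makes each index minus one a difference of
  lengths, which the least distance divides.\<close>

theorem least_distance:
  "distances G G0 \<noteq> {} \<longleftrightarrow> 0 < min_dist n (\<psi> ` G0)"
  "distances G G0 \<noteq> {} \<Longrightarrow> (LEAST d. d \<in> distances G G0) = min_dist n (\<psi> ` G0)"
proof -
  show "(LEAST d. d \<in> distances G G0) = min_dist n (\<psi> ` G0)" if ne: "distances G G0 \<noteq> {}"
  proof (rule dvd_antisym)
    have "(LEAST d. d \<in> distances G G0) \<in> distances G G0" using ne by (metis LeastI ex_in_conv)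
    then show "min_dist n (\<psi> ` G0) dvd (LEAST d. d \<in> distances G G0)"
      by (rule min_dist_dvd_distance)
    show "(LEAST d. d \<in> distances G G0) dvd min_dist n (\<psi> ` G0)"
      unfolding min_dist_def dvd_Gcd_iff
    proof
      fix x assume "x \<in> {i - 1 |i U. atom n (\<psi> ` G0) U \<and> \<Sum>\<^sub># U = n * i}"
      then obtain i U where x: "x = i - 1" "atom n (\<psi> ` G0) U" "\<Sum>\<^sub># U = n * i" by blast
      obtain B l where l: "l \<in> factorization_lengths G G0 B" "l + (i - 1) \<in> factorization_lengths G G0 B"
        using atom_lengths[OF x(2,3)] by blast
      show "(LEAST d. d \<in> distances G G0) dvd x"
      proof (cases "x = 0")
        case False
        then show ?thesis using least_distance_dvd[OF ne l] x(1) by simp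
      qed simp
    qed
  qed
  show "distances G G0 \<noteq> {} \<longleftrightarrow> 0 < min_dist n (\<psi> ` G0)"
  proof
    assume "distances G G0 \<noteq> {}"
    then obtain d where "d \<in> distances G G0" by blast
    then have "min_dist n (\<psi> ` G0) dvd d" "0 < d" by (rule min_dist_dvd_distance)+
    then show "0 < min_dist n (\<psi> ` G0)" by (cases "min_dist n (\<psi> ` G0)") auto
  next
    assume "0 < min_dist n (\<psi> ` G0)"
    then have "\<not> {i - 1 |i U. atom n (\<psi> ` G0) U \<and> \<Sum>\<^sub># U = n * i} \<subseteq> {0}"
      unfolding min_dist_def by (simp only: Gcd_0_iff[symmetric])
    then obtain x where "x \<in> {i - 1 |i U. atom n (\<psi> ` G0) U \<and> \<Sum>\<^sub># U = n * i}" "x \<noteq> 0" by blast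
    then obtain i U where x: "i - 1 \<noteq> 0" "atom n (\<psi> ` G0) U" "\<Sum>\<^sub># U = n * i" by blast
    obtain B l where l: "l \<in> factorization_lengths G G0 B" "l + (i - 1) \<in> factorization_lengths G G0 B"
      using atom_lengths[OF x(2,3)] by blast
    have "l < l + (i - 1)" using x(1) by simp
    then obtain d where "d \<in> distances G G0"
      using distance_le[OF zero_sum_seqs_of_length[OF l(1)] l] by blast
    then show "distances G G0 \<noteq> {}" by blast
  qed
qed

end

text \<open>The subgroups form a chain, so some \<open>b\<close> in \<open>G0\<close> generates all
  of \<open>G0\<close>, and logarithms to the base \<open>b\<close> give \<open>S\<close>.
  Conversely \<open>S\<close> with modulus \<open>m\<close> is realized by powers of an element of
  order \<open>m\<close>.\<close>

theorem Delta_star_cyclic_prime_power: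
  fixes G :: "('a, 'b) monoid_scheme" (structure) and p k :: nat
  assumes "group G" and cyc: "cyclic_group G" and p: "prime p" and ord: "order G = p ^ k"
  shows "Delta_star G = {min_dist m S | m S. m dvd order G \<and> S \<subseteq> {1..m} \<and> 1 \<in> S \<and> 0 < min_dist m S}"
    (is "_ = ?R")
proof -
  interpret group G by fact
  interpret comm_group G using cyc by (rule cyclic_imp_abelian_group)
  obtain c where c: "c \<in> carrier G" "subgroup_generated G {c} = G" using cyc unfolding cyclic_group_def by blast
  define N where "N = order G"
  have N0: "0 < N" unfolding N_def ord using p by (simp add: prime_gt_0_nat)
  have ordc: "ord c = N" using cyclic_order_is_ord[OF c(1)] c(2) unfolding N_def by simp
  have log: "\<exists>x::nat. g = c [^] x" if "g \<in> carrier G" for g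
  proof -
    have "g \<in> range (\<lambda>z::int. c [^] z)"
      using that carrier_subgroup_generated_by_singleton[OF c(1)] unfolding c(2) by (rule back_subst)
    then obtain z :: int where z: "g = c [^] z" by blast
    have "c [^] z = c [^] (z mod int N)"
      unfolding int_pow_eq[OF c(1)] ordc by (simp add: mod_eq_dvd_iff[symmetric])
    also have "\<dots> = c [^] int (nat (z mod int N))" using N0 by simp
    also have "\<dots> = c [^] nat (z mod int N)" by (rule int_pow_int)
    finally show ?thesis using z by blast
  qed
  have pow_reduce: "g [^] x = g [^] y" if "g \<in> carrier G" "[x = y] (mod ord g)" for g and x y :: nat
  proof -
    have "int (ord g) dvd int y - int x" using that(2) by (metis cong_iff_dvd_diff cong_int_iff cong_sym)
    then have "g [^] int x = g [^] int y" using int_pow_eq[OF that(1)] by blast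
    then show ?thesis by (simp add: int_pow_int)
  qed
  have "x \<in> ?R" if x: "x \<in> Delta_star G" for x
  proof -
    obtain G0 where g0: "G0 \<subseteq> carrier G" "distances G G0 \<noteq> {}" "x = (LEAST d. d \<in> distances G G0)"
      using x unfolding Delta_star_def by blast
    have "G0 \<noteq> {}"
    proof
      assume e: "G0 = {}"
      have "min_zero_sum_seqs G {} = {}"
        unfolding min_zero_sum_seqs_def zero_sum_seqs_def by auto
      then have "factorization_lengths G {} B \<subseteq> {0}" for B
        unfolding factorization_lengths_def by auto
      then have "distances G {} = {}" unfolding distances_def successive_distances_def by blast
      then show False using g0(2) e by simp
    qed
    define h where "h g = (SOME x::nat. g = c [^] x)" for g
    have h: "c [^] h g = g" if "g \<in> G0" for g
    proof -
      have "\<exists>x::nat. g = c [^] x" using log g0(1) that by blast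
      from someI_ex[OF this] show ?thesis unfolding h_def by simp
    qed
    \<comment> \<open>Each \<open>gcd (h g) N\<close> divides the prime power \<open>N\<close>;
      these divisors form a chain, so the least one divides all the others.\<close>
    obtain b where b: "b \<in> G0" "\<And>g. g \<in> G0 \<Longrightarrow> gcd (h b) N \<le> gcd (h g) N"
      using \<open>G0 \<noteq> {}\<close> by (meson ex_has_least_nat[of "\<lambda>g. g \<in> G0" _ "\<lambda>g. gcd (h g) N"] ex_in_conv)
    have bc: "b \<in> carrier G" using b(1) g0(1) by blast
    have ordb: "ord b dvd N" unfolding N_def by (rule ord_dvd_group_order[OF bc])
    have ob: "0 < ord b" using ordb N0 by (metis dvd_0_left_iff neq0_conv)
    have ex: "\<exists>t::nat. 1 \<le> t \<and> b [^] t = g" if g: "g \<in> G0" for g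
    proof -
      have "gcd (h b) N dvd p ^ k" "gcd (h g) N dvd p ^ k" unfolding N_def ord by auto
      then have "gcd (h b) N dvd gcd (h g) N \<or> gcd (h g) N dvd gcd (h b) N"
        using prime_power_divisors_chain[OF p] by blast
      moreover have "0 < gcd (h g) N" "0 < gcd (h b) N" using N0 by auto
      ultimately have "gcd (h b) N dvd gcd (h g) N"
        using b(2)[OF g] by (metis dvd_imp_le dvd_refl eq_iff)
      then have "gcd (h b) N dvd h g" by (metis dvd_trans gcd_dvd1)
      then obtain e where e: "h g = gcd (h b) N * e" by (elim dvdE)
      obtain y where "[h b * y = gcd (h b) N] (mod N)" using cong_solve_nat by blast
      then have "[h b * y * e = gcd (h b) N * e] (mod N)" by (rule cong_mult) simp
      \<comment> \<open>Adding \<open>N\<close> to the exponent makes it positive without changing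
        the power.\<close>
      then have "[h b * (y * e) + h b * N = h g] (mod N)" unfolding e
        by (metis add.right_neutral cong_0_iff cong_add dvd_triv_right mult.assoc)
      then have "c [^] (h b * (y * e + N)) = c [^] h g" unfolding distrib_left[of "h b" "y * e" N]
        by (intro pow_reduce[OF c(1)]) (simp add: ordc)
      then have "b [^] (y * e + N) = g" using h[OF g] h[OF b(1)] c(1) by (metis nat_pow_pow)
      then show ?thesis using N0 by (intro exI[of _ "y * e + N"]) simp
    qed
    define \<psi> where "\<psi> g = (LEAST t::nat. 1 \<le> t \<and> b [^] t = g)" for g
    have \<psi>: "1 \<le> \<psi> g \<and> b [^] \<psi> g = g" if "g \<in> G0" for g
      unfolding \<psi>_def using LeastI_ex[OF ex[OF that]] .
    \<comment> \<open>An exponent above \<open>ord b\<close> could be lowered by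
      \<open>ord b\<close> and would stay positive, against minimality.\<close>
    have \<psi>_le: "\<psi> g \<le> ord b" if "g \<in> G0" for g
    proof (rule ccontr)
      assume *: "\<not> \<psi> g \<le> ord b"
      then have "[\<psi> g - ord b = \<psi> g] (mod ord b)" by (simp add: cong_def le_mod_geq)
      then have "b [^] (\<psi> g - ord b) = b [^] \<psi> g" by (rule pow_reduce[OF bc])
      then have "b [^] (\<psi> g - ord b) = g" using \<psi>[OF that] by simp
      then have "1 \<le> \<psi> g - ord b \<and> b [^] (\<psi> g - ord b) = g" using * by simp
      then have "(LEAST t::nat. 1 \<le> t \<and> b [^] t = g) \<le> \<psi> g - ord b" by (rule Least_le)
      then have "\<psi> g \<le> \<psi> g - ord b" by (simp only: \<psi>_def)
      then show False using ob * by simp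
    qed
    have "\<psi> b \<le> 1" unfolding \<psi>_def by (rule Least_le) (use bc in simp)
    then have \<psi>b: "\<psi> b = 1" using \<psi>[OF b(1)] by simp
    interpret log_set G G0 b \<psi>
      by unfold_locales (use b g0 ob \<psi> \<psi>_le \<psi>b in auto)
    have "x = min_dist (ord b) (\<psi> ` G0)" "0 < min_dist (ord b) (\<psi> ` G0)"
      using least_distance(2)[OF g0(2)] least_distance(1) g0(2,3) by simp_all
    then show ?thesis using ordb S_facts unfolding N_def by blast
  qed
  moreover have "x \<in> Delta_star G" if x: "x \<in> ?R" for x
  proof -
    obtain m S where m: "m dvd N" "S \<subseteq> {1..m}" "1 \<in> S" "0 < min_dist m S" "x = min_dist m S"
      using x unfolding N_def by blast
    obtain j where j: "N = m * j" using m(1) by (elim dvdE)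
    have j0: "0 < j" "0 < m" using j N0 by auto
    define b where "b = c [^] j"
    have bc: "b \<in> carrier G" unfolding b_def using c(1) by simp
    have ob: "ord b = m" unfolding b_def using ord_pow[OF c(1), of j] ordc j j0 by simp
    define G0 where "G0 = (\<lambda>t. b [^] t) ` S"
    define \<psi> where "\<psi> g = (THE t::nat. t \<in> S \<and> b [^] t = g)" for g
    have uniq: "t = t'" if "t \<in> S" "t' \<in> S" "b [^] t = b [^] t'" for t t'
    proof -
      have "b [^] int t = b [^] int t'" using that(3) by (simp add: int_pow_int)
      then have "int m dvd int t' - int t" unfolding int_pow_eq[OF bc] ob .
      moreover have "\<bar>int t' - int t\<bar> < int m"
      proof -
        have "t \<in> {1..m}" "t' \<in> {1..m}" using that m(2) by auto
        then show ?thesis by auto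
      qed
      ultimately show ?thesis using zdvd_imp_le[of "int m" "\<bar>int t' - int t\<bar>"] by fastforce
    qed
    have \<psi>: "\<psi> (b [^] t) = t" if "t \<in> S" for t
      unfolding \<psi>_def by (rule the_equality) (use that uniq in auto)
    have img: "\<psi> ` G0 = S" unfolding G0_def image_image using \<psi> by simp
    have bG0: "b \<in> G0" unfolding G0_def using m(3) bc by (metis image_eqI nat_pow_eone)
    have \<psi>b: "\<psi> b = 1" using \<psi>[OF m(3)] bc by simp
    interpret log_set G G0 b \<psi>
      by unfold_locales (use bG0 \<psi>b bc ob j0 m(2) \<psi> in \<open>auto simp: G0_def\<close>)
    have ne: "distances G G0 \<noteq> {}" using least_distance(1) m(4) unfolding ob img by simp
    then have "x = (LEAST d. d \<in> distances G G0)" using least_distance(2) m(5) unfolding ob img by simp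
    then show ?thesis unfolding Delta_star_def using ne G0 by blast
  qed
  ultimately show ?thesis by blast
qed

theorem theorem7p2:
  fixes G :: "('a, 'b) monoid_scheme" and p k :: nat
  assumes "group G" and "cyclic_group G" and "prime p" and "order G = p ^ k"
  shows "Delta_star G \<inter> {l. (2 * real (order G) ^ 2) powr (1 / 3) \<le> real l} =
         (\<Union>m\<in>{m. m dvd order G}. I_set m) \<inter>
           {l. (2 * real (order G) ^ 2) powr (1 / 3) \<le> real l}"
proof -
  have DS: "Delta_star G = {min_dist m S | m S. m dvd order G \<and> S \<subseteq> {1..m} \<and> 1 \<in> S \<and> 0 < min_dist m S}"
    using Delta_star_cyclic_prime_power[OF assms] .
  have N0: "0 < order G" using assms by (simp add: prime_gt_0_nat)
  have "\<exists>m. m dvd order G \<and> l \<in> I_set m"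
    if l: "l \<in> Delta_star G" "(2 * real (order G) ^ 2) powr (1 / 3) \<le> real l" for l
  proof -
    obtain m S where m: "m dvd order G" "S \<subseteq> {1..m}" "1 \<in> S" "0 < min_dist m S" "l = min_dist m S"
      using l(1) unfolding DS by blast
    obtain j where j: "m = p ^ j" using m(1) assms by (metis divides_primepow_nat)
    have "((2 * real (order G) ^ 2) powr (1 / 3)) ^ 3 \<le> real l ^ 3"
      using l(2) by (intro power_mono) auto
    also have "((2 * real (order G) ^ 2) powr (1 / 3)) ^ 3 = 2 * real (order G) ^ 2"
      using N0 by (simp add: powr_power)
    finally have "real (2 * order G ^ 2) \<le> real (l ^ 3)" by simp
    then have cube: "2 * order G ^ 2 \<le> l ^ 3" by (simp only: of_nat_le_iff)
    have mN: "m \<le> order G" using m(1) N0 by (rule dvd_imp_le)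
    have "2 * m \<le> l * l"
    proof (cases "order G = 1")
      case True
      then have "m = 1" using m(1) by simp
      then have "S = {1}" using m(2,3) by auto
      then show ?thesis using m(4) \<open>m = 1\<close> min_dist_one by simp
    next
      case False
      define N where "N = order G"
      have N2: "2 \<le> N" using False N0 unfolding N_def by simp
      have "2 * N \<le> l * l"
      proof (rule ccontr)
        assume "\<not> 2 * N \<le> l * l"
        then have "(l * l) ^ 3 < (2 * N) ^ 3" by (intro power_strict_mono) auto
        moreover have "(2 * N ^ 2) ^ 2 \<le> (l ^ 3) ^ 2" using cube unfolding N_def by (rule power_mono) simp
        moreover have "(l * l) ^ 3 = (l ^ 3) ^ 2" by (simp add: power2_eq_square power3_eq_cube)
        moreover have "(2 * N ^ 2) ^ 2 = 4 * (N ^ 3 * N)" by (simp add: power2_eq_square power3_eq_cube)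
        moreover have "N ^ 3 * 2 \<le> N ^ 3 * N" using N2 by simp
        moreover have "(2 * N) ^ 3 = 8 * N ^ 3" by (simp add: power_mult_distrib)
        ultimately show False by linarith
      qed
      then show ?thesis using mN unfolding N_def by simp
    qed
    then obtain m' where "m' dvd m" "l \<in> I_set m'"
      using large_min_dist_in_I_set[OF assms(3), of S j] m unfolding j by auto
    then show ?thesis using m(1) by (meson dvd_trans)
  qed
  moreover have "l \<in> Delta_star G" if "m dvd order G" "l \<in> I_set m" for m l
    using I_set_realized[OF that(2)] that(1) unfolding DS by blast
  ultimately show ?thesis by blast
qed

end
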